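(* Let $G$ be a graph. \begin{itemize} \item If $G$ does not contain $P_3$ as a subgraph, then $o(G)=\mathcal{A}$. \item If $G$ contains $2P_3$, $C_4$ or the 3-sunlet as a subgraph, then $o(G)=\mathcal{E}$. \item In all other cases, $o(G)=\mathcal{SL}$. \end{itemize}
   Context: Graphs are finite simple graphs, viewed as 2-uniform hypergraphs (every edge has exactly 2 vertices). In the Avoider-Enforcer game on $G$, two players, Avoider and Enforcer, alternately pick one previously unpicked vertex of $G$ until all vertices have been picked. Enforcer wins if at the end Avoider has picked all the vertices of some edge of $G$; otherwise Avoider wins. The last player is the player who makes the last move of the game: this is the first player if $|V(G)|$ is odd and the second player if $|V(G)|$ is even; the other player is the second-to-last player. A player "wins as last (resp. second-to-last) player" if that player has a winning strategy when they are the last (resp. second-to-last) player. The outcome $o(G)$ is: $\mathcal{A}$ if Avoider wins both as last player and as second-to-last player; $\mathcal{E}$ if Enforcer wins both as last player and as second-to-last player; $\mathcal{SL}$ if whichever player is second-to-last wins. These are the only three possibilities. $P_n$ and $C_n$ denote the path and the cycle on $n$ vertices. $2P_3$ is the disjoint union of two copies of $P_3$. The 3-sunlet is the graph obtained from $C_3$ by attaching a pendent edge (to a new vertex) to each of its three vertices (so it has 6 vertices). Subgraphs are not necessarily induced. *)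

theory Defs
  imports Main
begin

section \<open>Finite simple graphs\<close>

record 'a graph =
  verts :: "'a set"
  edges :: "'a set set"

definition simple_graph :: "'a graph \<Rightarrow> bool" where
  "simple_graph G \<longleftrightarrow> finite (verts G) \<and> (\<forall>e\<in>edges G. e \<subseteq> verts G \<and> card e = 2)"

definition subgraph :: "'a graph \<Rightarrow> 'a graph \<Rightarrow> bool" where
  "subgraph H G \<longleftrightarrow> verts H \<subseteq> verts G \<and> edges H \<subseteq> edges G"

definition isomorphic :: "'a graph \<Rightarrow> 'b graph \<Rightarrow> bool" where
  "isomorphic H K \<longleftrightarrow>
     (\<exists>f. bij_betw f (verts H) (verts K) \<and> edges K = (\<lambda>e. f ` e) ` edges H)"

definition contains_subgraph :: "'a graph \<Rightarrow> 'b graph \<Rightarrow> bool" where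
  "contains_subgraph G H \<longleftrightarrow> (\<exists>H'. simple_graph H' \<and> subgraph H' G \<and> isomorphic H H')"

definition path_graph :: "nat \<Rightarrow> nat graph" where
  "path_graph n = \<lparr>verts = {..<n}, edges = {{i, Suc i} | i. Suc i < n}\<rparr>"

text \<open>Only meaningful for \<open>n \<ge> 3\<close>.\<close>

definition cycle_graph :: "nat \<Rightarrow> nat graph" where
  "cycle_graph n = \<lparr>verts = {..<n}, edges = {{i, Suc i mod n} | i. i < n}\<rparr>"

definition disjoint_union :: "'a graph \<Rightarrow> 'b graph \<Rightarrow> ('a + 'b) graph" where
  "disjoint_union G H =
     \<lparr>verts = verts G <+> verts H,
      edges = (\<lambda>e. Inl ` e) ` edges G \<union> (\<lambda>e. Inr ` e) ` edges H\<rparr>"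

text \<open>The cycle lives on the \<open>Inl\<close> copies; \<open>Inr i\<close> is the leaf attached to \<open>Inl i\<close>.\<close>

definition sunlet :: "nat \<Rightarrow> (nat + nat) graph" where
  "sunlet n =
     \<lparr>verts = {..<n} <+> {..<n},
      edges = (\<lambda>e. Inl ` e) ` edges (cycle_graph n) \<union> {{Inl i, Inr i} | i. i < n}\<rparr>"


section \<open>The Avoider-Enforcer game\<close>

datatype player = Avoider | Enforcer

fun opponent :: "player \<Rightarrow> player" where
  "opponent Avoider = Enforcer"
| "opponent Enforcer = Avoider"

text \<open>The player making move number \<open>i\<close> (counted from \<open>0\<close>) when \<open>f\<close> moves first.\<close>

definition mover :: "player \<Rightarrow> nat \<Rightarrow> player" where
  "mover f i = (if even i then f else opponent f)"

text \<open>A position is the list of vertices picked so far, earliest first.\<close>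

definition position :: "'a graph \<Rightarrow> 'a list \<Rightarrow> bool" where
  "position G h \<longleftrightarrow> distinct h \<and> set h \<subseteq> verts G"

definition complete_play :: "'a graph \<Rightarrow> 'a list \<Rightarrow> bool" where
  "complete_play G h \<longleftrightarrow> distinct h \<and> set h = verts G"

definition picked :: "player \<Rightarrow> player \<Rightarrow> 'a list \<Rightarrow> 'a set" where
  "picked f p h = {h ! i | i. i < length h \<and> mover f i = p}"

definition winner :: "'a graph \<Rightarrow> player \<Rightarrow> 'a list \<Rightarrow> player" where
  "winner G f h = (if \<exists>e\<in>edges G. e \<subseteq> picked f Avoider h then Enforcer else Avoider)"

type_synonym 'a strategy = "'a list \<Rightarrow> 'a"

definition legal_strategy :: "'a graph \<Rightarrow> player \<Rightarrow> player \<Rightarrow> 'a strategy \<Rightarrow> bool" where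
  "legal_strategy G f p s \<longleftrightarrow>
     (\<forall>h. position G h \<and> set h \<noteq> verts G \<and> mover f (length h) = p \<longrightarrow> s h \<in> verts G - set h)"

definition follows :: "player \<Rightarrow> player \<Rightarrow> 'a strategy \<Rightarrow> 'a list \<Rightarrow> bool" where
  "follows f p s h \<longleftrightarrow> (\<forall>i<length h. mover f i = p \<longrightarrow> h ! i = s (take i h))"

definition has_winning_strategy :: "'a graph \<Rightarrow> player \<Rightarrow> player \<Rightarrow> bool" where
  "has_winning_strategy G f p \<longleftrightarrow>
     (\<exists>s. legal_strategy G f p s \<and>
          (\<forall>h. complete_play G h \<and> follows f p s h \<longrightarrow> winner G f h = p))"

definition last_player :: "'a graph \<Rightarrow> player \<Rightarrow> player" where
  "last_player G f = (if odd (card (verts G)) then f else opponent f)"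

text \<open>In the next two definitions, the identity \<open>f\<close> of the first player is uniquely determined
  by \<open>p\<close> and the parity of the number of vertices.\<close>

definition wins_as_last :: "'a graph \<Rightarrow> player \<Rightarrow> bool" where
  "wins_as_last G p \<longleftrightarrow> (\<exists>f. last_player G f = p \<and> has_winning_strategy G f p)"

definition wins_as_second_to_last :: "'a graph \<Rightarrow> player \<Rightarrow> bool" where
  "wins_as_second_to_last G p \<longleftrightarrow>
     (\<exists>f. opponent (last_player G f) = p \<and> has_winning_strategy G f p)"

datatype outcome_class = \<A> | \<E> | \<S>\<L>

fun has_outcome :: "'a graph \<Rightarrow> outcome_class \<Rightarrow> bool" where
  "has_outcome G \<A> \<longleftrightarrow> wins_as_last G Avoider \<and> wins_as_second_to_last G Avoider"
| "has_outcome G \<E> \<longleftrightarrow> wins_as_last G Enforcer \<and> wins_as_second_to_last G Enforcer"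
| "has_outcome G \<S>\<L> \<longleftrightarrow> wins_as_second_to_last G Avoider \<and> wins_as_second_to_last G Enforcer"

text \<open>At most one outcome is possible by \<open>has_outcome_unique\<close> below, so an equation
  \<open>outcome G = x\<close> follows from \<open>has_outcome G x\<close>.\<close>

definition outcome :: "'a graph \<Rightarrow> outcome_class" where
  "outcome G = (THE x. has_outcome G x)"

lemma mover_opponent: "mover f i = p \<or> mover f i = opponent p"
  by (cases f; cases p) (auto simp: mover_def)

lemma opponent_neq [simp]: "opponent p \<noteq> p" "p \<noteq> opponent p"
  by (cases p; simp)+

lemma joint_play:
  assumes fin: "finite (verts G)"
    and s: "legal_strategy G f p s" and t: "legal_strategy G f (opponent p) t"
  shows "\<exists>h. complete_play G h \<and> follows f p s h \<and> follows f (opponent p) t h"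
proof -
  have "\<exists>h. position G h \<and> length h = n \<and> follows f p s h \<and> follows f (opponent p) t h"
    if "n \<le> card (verts G)" for n
    using that
  proof (induction n)
    case 0
    then show ?case by (auto simp: position_def follows_def)
  next
    case (Suc n)
    then obtain h where h: "position G h" "length h = n" "follows f p s h"
      "follows f (opponent p) t h" by auto
    have ne: "set h \<noteq> verts G"
      using h Suc.prems by (auto simp: position_def distinct_card dest: distinct_card)
    define v where "v = (if mover f n = p then s h else t h)"
    have v: "v \<in> verts G - set h"
      using s t h ne mover_opponent[of f n p]
      by (auto simp: v_def legal_strategy_def split: if_splits)
    have ext: "follows f q u (h @ [v])"
      if "follows f q u h" "mover f n = q \<Longrightarrow> v = u h" for q u
      using that h(2) by (auto simp: follows_def nth_append less_Suc_eq)
    have "follows f p s (h @ [v])" by (rule ext) (use h in \<open>auto simp: v_def\<close>)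
    moreover have "follows f (opponent p) t (h @ [v])"
      by (rule ext) (use h in \<open>auto simp: v_def\<close>)
    moreover have "position G (h @ [v])" using h v by (auto simp: position_def)
    ultimately show ?case using h(2) by (intro exI[of _ "h @ [v]"]) simp
  qed
  from this[of "card (verts G)"] obtain h where h: "position G h" "length h = card (verts G)"
    "follows f p s h" "follows f (opponent p) t h" by auto
  then have "set h = verts G"
    using fin by (metis card_subset_eq distinct_card position_def)
  then show ?thesis using h by (auto simp: complete_play_def position_def)
qed

lemma not_both_win:
  assumes "finite (verts G)" "has_winning_strategy G f p"
  shows "\<not> has_winning_strategy G f (opponent p)"
  using assms joint_play[OF assms(1)] unfolding has_winning_strategy_def
  by (metis opponent_neq(1))

lemma wins_as_last_imp_not_second_to_last:
  assumes "finite (verts G)" "wins_as_last G p"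
  shows "\<not> wins_as_second_to_last G (opponent p)"
proof -
  have "f = f'" if "last_player G f = p" "opponent (last_player G f') = opponent p" for f f'
    using that by (cases f; cases f'; cases p) (auto simp: last_player_def split: if_splits)
  then show ?thesis
    using assms not_both_win[OF assms(1)]
    unfolding wins_as_last_def wins_as_second_to_last_def by blast
qed

lemma has_outcome_unique:
  assumes "finite (verts G)" "has_outcome G x" "has_outcome G y"
  shows "x = y"
  using assms wins_as_last_imp_not_second_to_last[of G Avoider]
    wins_as_last_imp_not_second_to_last[of G Enforcer]
  by (cases x; cases y) auto

lemma outcome_eqI:
  assumes "finite (verts G)" "has_outcome G x"
  shows "outcome G = x"
  unfolding outcome_def using assms has_outcome_unique by blast

end

theory Submission
  imports Defs
begin

text \<open>Enforcer. A player never profits from moving more often, so a win of Enforcer as last player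
  on an even set of vertices, with Avoider moving first, is inherited by every larger board: extra
  vertices are played in pairs, and a single extra vertex can be treated as one that Avoider has
  already picked. It remains to play on \<open>2P\<^sub>3\<close>, \<open>C\<^sub>4\<close>, the 3-sunlet, and, as second-to-last
  player, on \<open>P\<^sub>3\<close>.

  Avoider. On a matching Avoider takes at most one end of each edge, and this still works when one
  further vertex, with arbitrary incidences, is reserved for Enforcer, who moves last. If the
  copies of \<open>P\<^sub>3\<close> pairwise intersect and there is neither a \<open>C\<^sub>4\<close> nor a 3-sunlet, then either
  one vertex meets all copies and is the reserved one, or there is a union \<open>B\<close> of components with
  five vertices outside of which the graph is a matching. In the latter case, deleting the vertex
  of \<open>B\<close> picked by Enforcer leaves a graph without \<open>C\<^sub>4\<close> on four vertices, which has a vertex of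
  degree at most 1; Avoider takes it and reserves its neighbour.\<close>

section \<open>Positions of the game\<close>

text \<open>The rest of a play depends only on the unpicked vertices \<open>U\<close>, Avoider's
  vertices \<open>A\<close> and the player \<open>q\<close> to move, so histories are forgotten;
  \<open>p\<close> is the player whose win is claimed.\<close>

inductive wins :: "'a set set \<Rightarrow> player \<Rightarrow> player \<Rightarrow> 'a set \<Rightarrow> 'a set \<Rightarrow> bool"
  for E :: "'a set set" and p :: player where
  over: "(p = Enforcer \<longleftrightarrow> (\<exists>e\<in>E. e \<subseteq> A)) \<Longrightarrow> wins E p q {} A"
| own: "v \<in> U \<Longrightarrow> wins E p (opponent p) (U - {v}) (if p = Avoider then insert v A else A)
    \<Longrightarrow> wins E p p U A"
| other: "U \<noteq> {} \<Longrightarrow>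
    (\<And>v. v \<in> U \<Longrightarrow> wins E p p (U - {v}) (if p = Avoider then A else insert v A))
    \<Longrightarrow> wins E p (opponent p) U A"

lemma opponent_opponent [simp]: "opponent (opponent p) = p"
  by (cases p) auto

lemma wins_empty_iff: "wins E p q {} A \<longleftrightarrow> (p = Enforcer \<longleftrightarrow> (\<exists>e\<in>E. e \<subseteq> A))"
proof
  assume "wins E p q {} A"
  then show "p = Enforcer \<longleftrightarrow> (\<exists>e\<in>E. e \<subseteq> A)" by cases auto
qed (rule wins.over)

lemma wins_own_iff:
  assumes "U \<noteq> {}"
  shows "wins E p p U A \<longleftrightarrow>
    (\<exists>v\<in>U. wins E p (opponent p) (U - {v}) (if p = Avoider then insert v A else A))"
proof
  assume "wins E p p U A"
  then show "\<exists>v\<in>U. wins E p (opponent p) (U - {v}) (if p = Avoider then insert v A else A)"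
    using assms by cases auto
qed (blast intro: wins.own)

lemma wins_other_iff:
  assumes "U \<noteq> {}"
  shows "wins E p (opponent p) U A \<longleftrightarrow>
    (\<forall>v\<in>U. wins E p p (U - {v}) (if p = Avoider then A else insert v A))"
proof
  assume "wins E p (opponent p) U A"
  then show "\<forall>v\<in>U. wins E p p (U - {v}) (if p = Avoider then A else insert v A)"
    using assms by cases auto
qed (rule wins.other[OF assms], blast)

lemma picked_snoc:
  "picked f p (h @ [v]) = (if mover f (length h) = p then insert v (picked f p h) else picked f p h)"
proof -
  have *: "i < length (h @ [v]) \<longleftrightarrow> i < length h \<or> i = length h" for i by auto
  have "picked f p (h @ [v]) = {h ! i | i. i < length h \<and> mover f i = p} \<union>
      {(h @ [v]) ! i | i. i = length h \<and> mover f i = p}"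
    unfolding picked_def * by (force simp: nth_append)
  then show ?thesis unfolding picked_def by auto
qed

text \<open>The strategy maintains the invariant \<open>good\<close>: on each own turn it moves to a
  position that is still won, and every move of the opponent preserves this. At the end the
  invariant names the winner.\<close>

lemma wins_imp_winning_strategy:
  assumes w: "wins (edges G) p f (verts G) {}"
  shows "has_winning_strategy G f p"
proof -
  define good where "good h \<longleftrightarrow>
    wins (edges G) p (mover f (length h)) (verts G - set h) (picked f Avoider h)" for h
  \<comment> \<open>The last branch keeps \<open>s\<close> legal in positions without a good move;
    \<open>legal_strategy\<close> speaks of all positions, not only of those reached under
    \<open>s\<close>.\<close>
  define s where "s h = (if \<exists>v\<in>verts G - set h. good (h @ [v])
    then SOME v. v \<in> verts G - set h \<and> good (h @ [v]) else SOME v. v \<in> verts G - set h)" for h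
  have legal: "legal_strategy G f p s"
    unfolding legal_strategy_def
  proof (intro allI impI)
    fix h assume h: "position G h \<and> set h \<noteq> verts G \<and> mover f (length h) = p"
    then have "\<exists>v. v \<in> verts G - set h" by (auto simp: position_def)
    then have 1: "(SOME v. v \<in> verts G - set h) \<in> verts G - set h" by (rule someI_ex)
    show "s h \<in> verts G - set h"
    proof (cases "\<exists>v\<in>verts G - set h. good (h @ [v])")
      case True
      then have "\<exists>v. v \<in> verts G - set h \<and> good (h @ [v])" by blast
      from someI_ex[OF this] True show ?thesis by (simp add: s_def)
    next
      case False
      then show ?thesis using 1 by (simp only: s_def if_False)
    qed
  qed
  have good_step: "good (h @ [v])"
    if g: "good h" and v: "v \<in> verts G - set h" and sv: "mover f (length h) = p \<Longrightarrow> v = s h" for h v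
  proof -
    have eq: "verts G - set (h @ [v]) = verts G - set h - {v}" by auto
    have mv: "mover f (Suc (length h)) = opponent (mover f (length h))"
      by (auto simp: mover_def)
    have ne: "verts G - set h \<noteq> {}" using v by auto
    show ?thesis
    proof (cases "mover f (length h) = p")
      case True
      have "\<exists>v\<in>verts G - set h. good (h @ [v])"
      proof -
        obtain u where u: "u \<in> verts G - set h" "wins (edges G) p (opponent p)
          (verts G - set h - {u}) (if p = Avoider then insert u (picked f Avoider h) else picked f Avoider h)"
          using g True wins_own_iff[OF ne] unfolding good_def by metis
        have "verts G - set (h @ [u]) = verts G - set h - {u}" by auto
        then have "good (h @ [u])" using u True mv unfolding good_def picked_snoc by simp
        then show ?thesis using u by blast
      qed
      then have "\<exists>v. v \<in> verts G - set h \<and> good (h @ [v])" by blast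
      from someI_ex[OF this] show ?thesis using sv[OF True] \<open>\<exists>v\<in>verts G - set h. good (h @ [v])\<close>
        by (simp add: s_def)
    next
      case False
      then have m: "mover f (length h) = opponent p" using mover_opponent by metis
      then have "wins (edges G) p p (verts G - set h - {v})
          (if p = Avoider then picked f Avoider h else insert v (picked f Avoider h))"
        using g v wins_other_iff[OF ne] unfolding good_def by metis
      then show ?thesis using m mv eq unfolding good_def picked_snoc
        by (cases p) simp_all
    qed
  qed
  have "winner G f h = p" if h: "complete_play G h" and fol: "follows f p s h" for h
  proof -
    have "good (take k h)" if "k \<le> length h" for k
      using that
    proof (induction k)
      case 0
      then show ?case using w by (simp add: good_def mover_def picked_def)
    next
      case (Suc k)
      have *: "take (Suc k) h = take k h @ [h ! k]" using Suc.prems by (simp add: take_Suc_conv_app_nth)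
      have "h ! k \<notin> set (take k h)"
        using h Suc.prems by (auto simp: complete_play_def in_set_conv_nth nth_eq_iff_index_eq)
      moreover have "h ! k \<in> verts G"
        using h Suc.prems nth_mem[of k h] by (simp add: complete_play_def)
      ultimately have "h ! k \<in> verts G - set (take k h)" by blast
      moreover have "good (take k h)" using Suc by simp
      moreover have "h ! k = s (take k h)" if "mover f (length (take k h)) = p"
        using that Suc.prems fol by (simp add: follows_def)
      ultimately show ?case unfolding * by (intro good_step)
    qed
    from this[of "length h"] have "wins (edges G) p (mover f (length h)) {} (picked f Avoider h)"
      using h by (simp add: good_def complete_play_def)
    then show ?thesis by (cases p) (auto simp: wins_empty_iff winner_def)
  qed
  then show ?thesis using legal unfolding has_winning_strategy_def by blast
qed

lemma wins_Enforcer_EnforcerI: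
  "v \<in> U \<Longrightarrow> wins E Enforcer Avoider (U - {v}) A \<Longrightarrow> wins E Enforcer Enforcer U A"
  using wins.own[of v U E Enforcer A] by simp

lemma wins_Enforcer_AvoiderI:
  assumes "U \<noteq> {}" "\<And>v. v \<in> U \<Longrightarrow> wins E Enforcer Enforcer (U - {v}) (insert v A)"
  shows "wins E Enforcer Avoider U A"
  using wins.other[of U E Enforcer A] assms by simp

lemma wins_Enforcer_EnforcerD:
  "wins E Enforcer Enforcer U A \<Longrightarrow> U \<noteq> {} \<Longrightarrow> \<exists>v\<in>U. wins E Enforcer Avoider (U - {v}) A"
  using wins_own_iff[of U E Enforcer A] by simp

lemma wins_Enforcer_AvoiderD:
  "wins E Enforcer Avoider U A \<Longrightarrow> v \<in> U \<Longrightarrow> wins E Enforcer Enforcer (U - {v}) (insert v A)"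
  using wins_other_iff[of U E Enforcer A] by auto

text \<open>The empty board is folded into this rule, so that later inductions on the board need no
  separate base case.\<close>

lemma wins_Avoider_EnforcerI:
  assumes "U = {} \<Longrightarrow> \<forall>e\<in>E. \<not> e \<subseteq> A" "\<And>v. v \<in> U \<Longrightarrow> wins E Avoider Avoider (U - {v}) A"
  shows "wins E Avoider Enforcer U A"
  using wins.other[of U E Avoider A] assms by (cases "U = {}") (auto simp: wins_empty_iff)

lemma wins_Avoider_AvoiderI:
  "v \<in> U \<Longrightarrow> wins E Avoider Enforcer (U - {v}) (insert v A) \<Longrightarrow> wins E Avoider Avoider U A"
  using wins.own[of v U E Avoider A] by simp

section \<open>Enforcer\<close>

text \<open>Avoider's set only grows, so an edge inside it stays there whatever is played.\<close>

lemma wins_Enforcer_if_edge: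
  assumes "finite U" "e \<in> E" "e \<subseteq> A"
  shows "wins E Enforcer q U A"
  using assms
proof (induction "card U" arbitrary: U A q)
  case 0
  then show ?case by (auto simp: wins_empty_iff)
next
  case (Suc n)
  have ne: "U \<noteq> {}" using Suc.hyps(2) by auto
  have step: "wins E Enforcer r (U - {v}) B" if "v \<in> U" "A \<subseteq> B" for v r B
    using Suc that by (intro Suc.hyps(1)) auto
  show ?case
  proof (cases q)
    case Avoider
    show ?thesis unfolding Avoider by (rule wins_Enforcer_AvoiderI[OF ne]) (auto intro: step)
  next
    case Enforcer
    from ne obtain v where "v \<in> U" by blast
    then show ?thesis unfolding Enforcer by (rule wins_Enforcer_EnforcerI) (auto intro: step \<open>v \<in> U\<close>)
  qed
qed

text \<open>Enforcer keeps the same moves; Avoider's set remains a superset and finally contains the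
  same edge.\<close>

lemma wins_Enforcer_mono:
  assumes "wins E Enforcer q U A" "A \<subseteq> B" "finite U"
  shows "wins E Enforcer q U B"
  using assms
proof (induction "card U" arbitrary: U A B q)
  case 0
  then show ?case by (auto simp: wins_empty_iff)
next
  case (Suc n)
  have ne: "U \<noteq> {}" using Suc.hyps(2) by auto
  have step: "wins E Enforcer r (U - {v}) D" if "v \<in> U" "wins E Enforcer r (U - {v}) C" "C \<subseteq> D" for v r C D
    by (rule Suc.hyps(1)[OF _ that(2,3)]) (use Suc.hyps(2) Suc.prems(3) that(1) in simp_all)
  show ?case
  proof (cases q)
    case Avoider
    show ?thesis unfolding Avoider
    proof (rule wins_Enforcer_AvoiderI[OF ne])
      fix v assume v: "v \<in> U"
      then have "wins E Enforcer Enforcer (U - {v}) (insert v A)"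
        using Suc.prems Avoider by (simp add: wins_Enforcer_AvoiderD)
      then show "wins E Enforcer Enforcer (U - {v}) (insert v B)"
        by (rule step[OF v]) (use Suc.prems in auto)
    qed
  next
    case Enforcer
    then obtain v where v: "v \<in> U" "wins E Enforcer Avoider (U - {v}) A"
      using Suc.prems ne by (auto dest: wins_Enforcer_EnforcerD)
    show ?thesis unfolding Enforcer
      by (rule wins_Enforcer_EnforcerI[OF v(1) step[OF v Suc.prems(2)]])
  qed
qed

text \<open>Enforcer answers \<open>x\<close> with \<open>y\<close> and conversely. The extra vertex
  that goes to Avoider does no harm, by \<open>wins_Enforcer_mono\<close>.\<close>

lemma wins_Enforcer_insert2:
  assumes "wins E Enforcer q U A" "finite U" "x \<notin> U" "y \<notin> U" "x \<noteq> y"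
  shows "wins E Enforcer q (insert x (insert y U)) A"
  using assms
proof (induction "card U" arbitrary: U A q rule: less_induct)
  case less
  let ?U = "insert x (insert y U)"
  \<comment> \<open>The position with Enforcer to move is needed both for \<open>U\<close> itself
    and for \<open>U\<close> after a pick of Avoider, so the induction hypothesis enters as the
    assumption \<open>IH\<close>.\<close>
  have En: "wins E Enforcer Enforcer (insert x (insert y U)) A"
    if w: "wins E Enforcer Enforcer U A" and sub: "finite U" "x \<notin> U" "y \<notin> U"
      and IH: "\<And>v. v \<in> U \<Longrightarrow> wins E Enforcer Avoider (U - {v}) A
        \<Longrightarrow> wins E Enforcer Avoider (insert x (insert y (U - {v}))) A" for U A
  proof (cases "U = {}")
    \<comment> \<open>With \<open>U\<close> used up there is already an edge inside
      \<open>A\<close>, so the moves on \<open>x\<close> and \<open>y\<close> are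
      irrelevant.\<close>
    case True
    then obtain e where "e \<in> E" "e \<subseteq> A" using w by (auto simp: wins_empty_iff)
    then show ?thesis using sub by (intro wins_Enforcer_if_edge) auto
  next
    case False
    then obtain v where v: "v \<in> U" "wins E Enforcer Avoider (U - {v}) A"
      using w by (blast dest: wins_Enforcer_EnforcerD)
    have "insert x (insert y U) - {v} = insert x (insert y (U - {v}))" using v sub by auto
    then show ?thesis using IH[OF v] v by (intro wins_Enforcer_EnforcerI[of v]) auto
  qed
  show ?case
  proof (cases q)
    case Enforcer
    show ?thesis unfolding Enforcer
    proof (rule En)
      fix v assume v: "v \<in> U" "wins E Enforcer Avoider (U - {v}) A"
      then have "card (U - {v}) < card U" using less.prems by (intro psubset_card_mono) auto
      from less.hyps[OF this v(2)] show "wins E Enforcer Avoider (insert x (insert y (U - {v}))) A"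
        using less.prems by simp
    qed (use less.prems Enforcer in simp_all)
  next
    case Avoider
    show ?thesis unfolding Avoider
    proof (rule wins_Enforcer_AvoiderI)
      fix v assume v: "v \<in> ?U"
      \<comment> \<open>Avoider takes \<open>a\<close> from the pair and Enforcer takes
        \<open>b\<close>: the old position with one more vertex for Avoider.\<close>
      have xy: "wins E Enforcer Enforcer (insert b U) (insert a A)" if "b \<notin> U" for a b
      proof (rule wins_Enforcer_EnforcerI)
        have "wins E Enforcer Avoider U (insert a A)"
          using less.prems(1,2) unfolding Avoider by (rule wins_Enforcer_mono[OF _ subset_insertI])
        then show "wins E Enforcer Avoider (insert b U - {b}) (insert a A)" using that by simp
      qed simp
      show "wins E Enforcer Enforcer (?U - {v}) (insert v A)"
      proof (cases "v \<in> U")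
        case True
        then have eq: "?U - {v} = insert x (insert y (U - {v}))" using less.prems by auto
        show ?thesis unfolding eq
        proof (rule En)
          show "wins E Enforcer Enforcer (U - {v}) (insert v A)"
            using less.prems True Avoider by (auto dest: wins_Enforcer_AvoiderD)
          fix w assume w: "w \<in> U - {v}" "wins E Enforcer Avoider (U - {v} - {w}) (insert v A)"
          then have "card (U - {v} - {w}) < card U"
            using less.prems True by (intro psubset_card_mono) auto
          from less.hyps[OF this w(2)]
          show "wins E Enforcer Avoider (insert x (insert y (U - {v} - {w}))) (insert v A)"
            using less.prems by simp
        qed (use less.prems in simp_all)
      next
        case False
        then consider "v = x" | "v = y" using v by auto
        then show ?thesis
        proof cases
          case 1
          then have "?U - {v} = insert y U" using less.prems by auto
          then show ?thesis using xy less.prems by simp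
        next
          case 2
          then have "?U - {v} = insert x U" using less.prems by auto
          then show ?thesis using xy less.prems by simp
        qed
      qed
    qed simp
  qed
qed

text \<open>The vertices outside \<open>H\<close> are added two at a time by
  \<open>wins_Enforcer_insert2\<close>.\<close>

lemma wins_Enforcer_superset:
  assumes "wins E Enforcer q H A" "H \<subseteq> U" "finite U" "even (card (U - H))"
  shows "wins E Enforcer q U A"
  using assms
proof (induction "card (U - H)" arbitrary: H rule: less_induct)
  case less
  show ?case
  proof (cases "U = H")
    case True
    then show ?thesis using less.prems by simp
  next
    case False
    then obtain x where x: "x \<in> U - H" using less.prems by auto
    have fin: "finite (U - H)" using less.prems by auto
    have c: "card (U - H - {x}) = card (U - H) - 1" using x fin by simp
    have "card (U - H) > 0" using x fin by (auto simp: card_gt_0_iff)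
    with c less.prems(4) have "odd (card (U - H - {x}))" by auto
    then obtain y where y: "y \<in> U - H - {x}" by (metis all_not_in_conv card.empty even_zero)
    then have "card (U - H - {x} - {y}) = card (U - H) - 2" using c fin by simp
    moreover have "U - insert x (insert y H) = U - H - {x} - {y}" by auto
    ultimately have c2: "card (U - insert x (insert y H)) = card (U - H) - 2" by simp
    have "finite H" using less.prems finite_subset by auto
    then have w: "wins E Enforcer q (insert x (insert y H)) A"
      using x y less.prems by (intro wins_Enforcer_insert2) auto
    show ?thesis
      by (rule less.hyps[OF _ w]) (use c2 x y less.prems \<open>card (U - H) > 0\<close> in auto)
  qed
qed

text \<open>Enforcer answers as if Avoider had already picked \<open>v\<close>; moving last, Enforcer
  eventually makes Avoider pick \<open>v\<close>.\<close>

lemma wins_Enforcer_delay: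
  assumes "finite U" "even (card U)"
  shows "(wins E Enforcer Avoider U A \<longrightarrow> wins E Enforcer Enforcer U A) \<and>
    (v \<notin> U \<longrightarrow> wins E Enforcer Avoider U (insert v A) \<longrightarrow> wins E Enforcer Avoider (insert v U) A)"
  using assms
proof (induction "card U" arbitrary: U A v rule: less_induct)
  case less
  \<comment> \<open>After a pick \<open>x\<close> of Avoider an odd number of vertices is left, so
    Enforcer does have a reply \<open>y\<close>, and the board is even again afterwards.\<close>
  have two: "\<exists>y\<in>U - {x}. even (card (U - {x} - {y})) \<and> card (U - {x} - {y}) < card U \<and>
      wins E Enforcer Avoider (U - {x} - {y}) B"
    if x: "x \<in> U" and w: "wins E Enforcer Enforcer (U - {x}) B" for x B
  proof -
    have "Suc (card (U - {x})) = card U" using x less.prems(1) by (intro card_Suc_Diff1)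
    with less.prems(2) have "odd (card (U - {x}))" by (metis even_Suc)
    then have "U - {x} \<noteq> {}" by (metis card.empty even_zero)
    then obtain y where y: "y \<in> U - {x}" "wins E Enforcer Avoider (U - {x} - {y}) B"
      using wins_Enforcer_EnforcerD[OF w] by blast
    moreover have "even (card (U - {x} - {y}))"
      using y(1) \<open>odd (card (U - {x}))\<close> less.prems by simp
    moreover have "card (U - {x} - {y}) < card U"
      using x less.prems by (intro psubset_card_mono) auto
    ultimately show ?thesis by blast
  qed
  \<comment> \<open>Enforcer pretends that Avoider has picked \<open>x\<close> and makes the winning
    reply \<open>y\<close>; the second claim, on the smaller board, then turns \<open>x\<close> back
    into a free vertex.\<close>
  have pass: "wins E Enforcer Enforcer U A" if w: "wins E Enforcer Avoider U A" for A
  proof (cases "U = {}")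
    case True
    then show ?thesis using w by (simp add: wins_empty_iff)
  next
    case False
    then obtain x where x: "x \<in> U" by auto
    from two[OF x wins_Enforcer_AvoiderD[OF w x]] obtain y where y: "y \<in> U - {x}"
      "even (card (U - {x} - {y}))" "card (U - {x} - {y}) < card U"
      "wins E Enforcer Avoider (U - {x} - {y}) (insert x A)" by blast
    have "wins E Enforcer Avoider (insert x (U - {x} - {y})) A"
      using less.hyps[OF y(3) _ y(2)] less.prems(1) y(4) by simp
    moreover have "insert x (U - {x} - {y}) = U - {y}" using x y by auto
    ultimately have "wins E Enforcer Avoider (U - {y}) A" by simp
    with y(1) show ?thesis by (intro wins_Enforcer_EnforcerI[of y]) auto
  qed
  moreover have "wins E Enforcer Avoider (insert v U) A"
    if v: "v \<notin> U" and w: "wins E Enforcer Avoider U (insert v A)"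
  proof (rule wins_Enforcer_AvoiderI)
    fix x assume "x \<in> insert v U"
    show "wins E Enforcer Enforcer (insert v U - {x}) (insert x A)"
    proof (cases "x = v")
      \<comment> \<open>The pick of \<open>v\<close> makes the pretence true but leaves Enforcer to
        move, which is the first claim on the same board.\<close>
      case True
      then show ?thesis using pass[OF w] v by simp
    next
      case False
      then have x: "x \<in> U" using \<open>x \<in> insert v U\<close> by auto
      from two[OF x wins_Enforcer_AvoiderD[OF w x]] obtain y where y: "y \<in> U - {x}"
        "even (card (U - {x} - {y}))" "card (U - {x} - {y}) < card U"
        "wins E Enforcer Avoider (U - {x} - {y}) (insert v (insert x A))"
        unfolding insert_commute[of v] by blast
      have "wins E Enforcer Avoider (insert v (U - {x} - {y})) (insert x A)"
        using less.hyps[OF y(3) _ y(2)] less.prems(1) y(4) v by simp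
      moreover have "insert v (U - {x} - {y}) = insert v U - {x} - {y}" using x y v by auto
      ultimately have "wins E Enforcer Avoider (insert v U - {x} - {y}) (insert x A)" by simp
      with y(1) show ?thesis by (intro wins_Enforcer_EnforcerI[of y]) auto
    qed
  qed simp
  ultimately show ?case by blast
qed

lemmas wins_Enforcer_pass = wins_Enforcer_delay[THEN conjunct1, rule_format]
  and wins_Enforcer_unpick = wins_Enforcer_delay[THEN conjunct2, rule_format]

section \<open>Winning positions of Enforcer on small boards\<close>

text \<open>Avoider is forced to pick, and every pick completes an edge with a vertex of
  \<open>A\<close>.\<close>

lemma wins_Enforcer_all_adjacent:
  assumes "finite U" "U \<noteq> {}" "\<And>x. x \<in> U \<Longrightarrow> \<exists>a\<in>A. {a, x} \<in> E"
  shows "wins E Enforcer Avoider U A"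
proof (rule wins_Enforcer_AvoiderI[OF assms(2)])
  fix v assume "v \<in> U"
  then obtain a where "a \<in> A" "{a, v} \<in> E" using assms(3) by blast
  then show "wins E Enforcer Enforcer (U - {v}) (insert v A)"
    using assms(1) wins_Enforcer_if_edge[of "U - {v}" "{a, v}" E "insert v A"] by auto
qed

text \<open>The only harmless pick is \<open>z\<close>. Enforcer then takes \<open>x\<close>, and
  \<open>y\<close> keeps the board nonempty, so Avoider's next pick completes an edge.\<close>

lemma wins_Enforcer_all_adjacent_but_one:
  assumes "finite X" "x \<in> X" "y \<in> X" "x \<noteq> y" "\<And>x. x \<in> X \<Longrightarrow> \<exists>a\<in>A. {a, x} \<in> E" "z \<notin> X"
  shows "wins E Enforcer Avoider (insert z X) A"
proof (rule wins_Enforcer_AvoiderI)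
  fix v assume v: "v \<in> insert z X"
  show "wins E Enforcer Enforcer (insert z X - {v}) (insert v A)"
  proof (cases "v = z")
    case True
    have "wins E Enforcer Avoider (X - {x}) (insert z A)"
      using assms by (intro wins_Enforcer_all_adjacent) auto
    then show ?thesis using assms True by (intro wins_Enforcer_EnforcerI[of x]) auto
  next
    case False
    then obtain a where "a \<in> A" "{a, v} \<in> E" using assms(5) v by blast
    then show ?thesis
      using assms(1) wins_Enforcer_if_edge[of "insert z X - {v}" "{a, v}" E "insert v A"] by auto
  qed
qed simp

text \<open>A pick on the path is answered on the path, leaving there only a neighbour of the picked
  vertex; then every free vertex is adjacent to one of Avoider's.\<close>

lemma wins_Enforcer_P3_and_adjacent:
  assumes "finite X" "\<And>x. x \<in> X \<Longrightarrow> \<exists>a\<in>A. {a, x} \<in> E"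
    and e: "{d, e} \<in> E" "{e, f} \<in> E" and dist: "distinct [d, e, f]" "{d, e, f} \<inter> X = {}"
  shows "wins E Enforcer Avoider ({d, e, f} \<union> X) A"
proof (rule wins_Enforcer_AvoiderI)
  fix v assume v: "v \<in> {d, e, f} \<union> X"
  \<comment> \<open>\<open>u\<close> is a neighbour of the picked vertex \<open>v\<close> on the
    path, and \<open>w\<close> is the third path vertex, which Enforcer takes.\<close>
  have reply: "wins E Enforcer Enforcer (({d, e, f} \<union> X) - {v}) (insert v A)"
    if eq: "{d, e, f} = {v, u, w}" and e: "{v, u} \<in> E" and dist: "distinct [v, u, w]" for u w
  proof (rule wins_Enforcer_EnforcerI)
    have "{v, u, w} \<inter> X = {}" using assms(6) eq by simp
    then have *: "({v, u, w} \<union> X) - {v} - {w} = insert u X" "w \<in> ({v, u, w} \<union> X) - {v}"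
      using dist by auto
    show "w \<in> ({d, e, f} \<union> X) - {v}" unfolding eq by (rule *)
    show "wins E Enforcer Avoider (({d, e, f} \<union> X) - {v} - {w}) (insert v A)"
      unfolding eq * by (rule wins_Enforcer_all_adjacent) (use assms(1,2) e in auto)
  qed
  from v consider "v = d" | "v = e" | "v = f" | "v \<in> X" by blast
  then show "wins E Enforcer Enforcer (({d, e, f} \<union> X) - {v}) (insert v A)"
  proof cases
    case 1
    show ?thesis by (rule reply[of e f]) (use 1 dist e in auto)
  next
    case 2
    show ?thesis by (rule reply[of f d]) (use 2 dist e in auto)
  next
    case 3
    show ?thesis by (rule reply[of e d]) (use 3 dist e in \<open>auto simp: insert_commute\<close>)
  next
    case 4
    then obtain a where "a \<in> A" "{a, v} \<in> E" using assms(2) by blast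
    then show ?thesis
      using assms(1) wins_Enforcer_if_edge[of "({d, e, f} \<union> X) - {v}" "{a, v}" E "insert v A"] by auto
  qed
qed simp

lemma wins_Enforcer_P3:
  assumes "{d, e} \<in> E" "{e, f} \<in> E" "distinct [d, e, f]"
  shows "wins E Enforcer Avoider {d, e, f} A"
  using wins_Enforcer_P3_and_adjacent[of "{}" A E d e f] assms by simp

text \<open>By symmetry Avoider opens on the first path. The reply leaves one neighbour of the pick
  together with the whole other path, a board for
  \<open>wins_Enforcer_P3_and_adjacent\<close>.\<close>

lemma wins_Enforcer_2P3:
  assumes e: "{a, b} \<in> E" "{b, c} \<in> E" "{d, e} \<in> E" "{e, f} \<in> E"
    and dist: "distinct [a, b, c, d, e, f]"
  shows "wins E Enforcer Avoider {a, b, c, d, e, f} {}"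
proof (rule wins_Enforcer_AvoiderI)
  have reply: "wins E Enforcer Enforcer ({v, u, w, d, e, f} - {v}) {v}"
    if e: "{v, u} \<in> E" "{d, e} \<in> E" "{e, f} \<in> E" and dist: "distinct [v, u, w, d, e, f]"
    for u v w d e f
  proof (rule wins_Enforcer_EnforcerI)
    show "w \<in> {v, u, w, d, e, f} - {v}" using dist by auto
    have eq: "{v, u, w, d, e, f} - {v} - {w} = {d, e, f} \<union> {u}" using dist by auto
    show "wins E Enforcer Avoider ({v, u, w, d, e, f} - {v} - {w}) {v}"
      unfolding eq by (rule wins_Enforcer_P3_and_adjacent) (use e dist in auto)
  qed
  have half: "wins E Enforcer Enforcer ({a, b, c, d, e, f} - {v}) {v}"
    if v: "v \<in> {a, b, c}" and e: "{a, b} \<in> E" "{b, c} \<in> E" "{d, e} \<in> E" "{e, f} \<in> E"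
      and dist: "distinct [a, b, c, d, e, f]" for v a b c d e f
  proof -
    have eq: "{a, b, c, d, e, f} = {b, c, a, d, e, f}" "{a, b, c, d, e, f} = {c, b, a, d, e, f}" by auto
    from v consider "v = a" | "v = b" | "v = c" by blast
    then show ?thesis
    proof cases
      case 1
      show ?thesis unfolding 1 by (rule reply) (use dist e in auto)
    next
      case 2
      show ?thesis unfolding 2 eq(1) by (rule reply) (use dist e in auto)
    next
      case 3
      show ?thesis unfolding 3 eq(2) by (rule reply) (use dist e in \<open>auto simp: insert_commute\<close>)
    qed
  qed
  fix v assume "v \<in> {a, b, c, d, e, f}"
  then consider "v \<in> {a, b, c}" | "v \<in> {d, e, f}" by blast
  then show "wins E Enforcer Enforcer ({a, b, c, d, e, f} - {v}) {v}"
  proof cases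
    case 1
    then show ?thesis using half e dist by blast
  next
    case 2
    have "{a, b, c, d, e, f} = {d, e, f, a, b, c}" by auto
    moreover have "wins E Enforcer Enforcer ({d, e, f, a, b, c} - {v}) {v}"
      by (rule half) (use 2 e dist in auto)
    ultimately show ?thesis by simp
  qed
qed simp

text \<open>Enforcer answers with the opposite vertex; the two vertices left are both neighbours of
  Avoider's pick.\<close>

lemma wins_Enforcer_C4:
  assumes e: "{a, b} \<in> E" "{b, c} \<in> E" "{c, d} \<in> E" "{d, a} \<in> E"
    and dist: "distinct [a, b, c, d]"
  shows "wins E Enforcer Avoider {a, b, c, d} {}"
proof (rule wins_Enforcer_AvoiderI)
  have reply: "wins E Enforcer Enforcer ({a, b, c, d} - {a}) {a}"
    if "{a, b} \<in> E" "{d, a} \<in> E" "distinct [a, b, c, d]" for a b c d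
  proof (rule wins_Enforcer_EnforcerI)
    show "c \<in> {a, b, c, d} - {a}" using that by auto
    show "wins E Enforcer Avoider ({a, b, c, d} - {a} - {c}) {a}"
      using that by (intro wins_Enforcer_all_adjacent) (auto simp: insert_commute)
  qed
  fix v assume "v \<in> {a, b, c, d}"
  moreover have "{b, c, d, a} = {a, b, c, d}" "{c, d, a, b} = {a, b, c, d}" "{d, a, b, c} = {a, b, c, d}"
    by auto
  ultimately show "wins E Enforcer Enforcer ({a, b, c, d} - {v}) {v}"
    using reply[of a b d c] reply[of b c a d] reply[of c d b a] reply[of d a c b] e dist by auto
qed simp

text \<open>Up to rotation Avoider opens with \<open>x\<close> or its leaf \<open>x'\<close>; the
  leaf \<open>y'\<close> is a winning reply to both.\<close>

lemma wins_Enforcer_3_sunlet: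
  assumes e: "{x, y} \<in> E" "{y, z} \<in> E" "{z, x} \<in> E" "{x, x'} \<in> E" "{y, y'} \<in> E" "{z, z'} \<in> E"
    and dist: "distinct [x, y, z, x', y', z']"
  shows "wins E Enforcer Avoider {x, y, z, x', y', z'} {}"
proof (rule wins_Enforcer_AvoiderI)
  have reply: "wins E Enforcer Enforcer ({x, y, z, x', y', z'} - {v}) {v}"
    if e: "{x, y} \<in> E" "{y, z} \<in> E" "{z, x} \<in> E" "{x, x'} \<in> E" "{y, y'} \<in> E" "{z, z'} \<in> E"
      and dist: "distinct [x, y, z, x', y', z']" and v: "v = x \<or> v = x'" for x y z x' y' z' v
  proof (rule wins_Enforcer_EnforcerI)
    show "y' \<in> {x, y, z, x', y', z'} - {v}" using dist v by auto
    from v show "wins E Enforcer Avoider ({x, y, z, x', y', z'} - {v} - {y'}) {v}"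
    proof
      \<comment> \<open>Now \<open>y\<close>, \<open>z\<close> and \<open>x'\<close> are all
        adjacent to \<open>x\<close>, and only \<open>z'\<close> is a safe pick.\<close>
      assume v: "v = x"
      have "{x, y, z, x', y', z'} - {v} - {y'} = insert z' {y, z, x'}" using dist v by auto
      moreover have "wins E Enforcer Avoider (insert z' {y, z, x'}) {v}"
        by (rule wins_Enforcer_all_adjacent_but_one[of _ y z])
          (use dist e v in \<open>auto simp: insert_commute\<close>)
      ultimately show ?thesis by simp
    next
      \<comment> \<open>What remains is the path \<open>y\<close>, \<open>z\<close>,
        \<open>z'\<close> together with \<open>x\<close>, the neighbour of
        \<open>x'\<close>.\<close>
      assume v: "v = x'"
      have "{x, y, z, x', y', z'} - {v} - {y'} = {y, z, z'} \<union> {x}" using dist v by auto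
      moreover have "wins E Enforcer Avoider ({y, z, z'} \<union> {x}) {v}"
        by (rule wins_Enforcer_P3_and_adjacent) (use dist e v in \<open>auto simp: insert_commute\<close>)
      ultimately show ?thesis by simp
    qed
  qed
  fix v assume "v \<in> {x, y, z, x', y', z'}"
  then consider "v = x \<or> v = x'" | "v = y \<or> v = y'" | "v = z \<or> v = z'" by blast
  then show "wins E Enforcer Enforcer ({x, y, z, x', y', z'} - {v}) {v}"
  proof cases
    case 1
    then show ?thesis using reply e dist by blast
  next
    case 2
    have "wins E Enforcer Enforcer ({y, z, x, y', z', x'} - {v}) {v}"
      by (rule reply) (use 2 e dist in auto)
    moreover have "{y, z, x, y', z', x'} = {x, y, z, x', y', z'}" by auto
    ultimately show ?thesis by simp
  next
    case 3
    have "wins E Enforcer Enforcer ({z, x, y, z', x', y'} - {v}) {v}"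
      by (rule reply) (use 3 e dist in auto)
    moreover have "{z, x, y, z', x', y'} = {x, y, z, x', y', z'}" by auto
    ultimately show ?thesis by simp
  qed
qed simp

section \<open>Parity of the board and wins of Enforcer\<close>

text \<open>The conditional is the identity of the first player: the last player opens exactly on
  odd boards.\<close>

lemma wins_imp_wins_as_last:
  assumes "wins (edges G) p (if odd (card (verts G)) then p else opponent p) (verts G) {}"
  shows "wins_as_last G p"
  unfolding wins_as_last_def last_player_def
  using wins_imp_winning_strategy[OF assms]
  by (intro exI[of _ "if odd (card (verts G)) then p else opponent p"]) auto

lemma wins_imp_wins_as_second_to_last:
  assumes "wins (edges G) p (if odd (card (verts G)) then opponent p else p) (verts G) {}"
  shows "wins_as_second_to_last G p"
  unfolding wins_as_second_to_last_def last_player_def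
  using wins_imp_winning_strategy[OF assms]
  by (intro exI[of _ "if odd (card (verts G)) then opponent p else p"]) auto

text \<open>Enforcer spends the opening move on a vertex outside \<open>H\<close>; the remaining
  extra vertices come in pairs.\<close>

lemma wins_Enforcer_superset_odd_diff:
  assumes "wins E Enforcer Avoider H A" "H \<subseteq> U" "finite U" "odd (card (U - H))"
  shows "wins E Enforcer Enforcer U A"
proof -
  have "U - H \<noteq> {}" using assms(4) by (metis card.empty even_zero)
  then obtain x where x: "x \<in> U - H" by blast
  have "U - {x} - H = U - H - {x}" by auto
  moreover have "card (U - H) = Suc (card (U - H - {x}))"
    using x assms(3) by (intro card_Suc_Diff1[symmetric]) auto
  ultimately have "even (card (U - {x} - H))" using assms(4) by simp
  then have "wins E Enforcer Avoider (U - {x}) A"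
    using assms x by (intro wins_Enforcer_superset[OF assms(1)]) auto
  then show ?thesis using x by (intro wins_Enforcer_EnforcerI[of x]) auto
qed

text \<open>Avoider opens on the odd board \<open>H\<close>, so Enforcer is second-to-last there.
  This role persists on the larger board: Avoider still opens if the number of extra vertices is
  even, and Enforcer opens outside \<open>H\<close> if it is odd.\<close>

lemma wins_as_second_to_last_Enforcer_if_odd:
  assumes "wins (edges G) Enforcer Avoider H {}" "H \<subseteq> verts G" "finite (verts G)" "odd (card H)"
  shows "wins_as_second_to_last G Enforcer"
proof -
  have "card (verts G) = card (verts G - H) + card H"
    using assms(2,3) by (metis card_Diff_subset card_mono finite_subset le_add_diff_inverse2)
  then have "odd (card (verts G)) \<longleftrightarrow> even (card (verts G - H))" using assms(4) by simp
  then show ?thesis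
    using wins_Enforcer_superset[OF assms(1-3)] wins_Enforcer_superset_odd_diff[OF assms(1-3)] assms(3)
    by (intro wins_imp_wins_as_second_to_last) simp_all
qed

text \<open>On an even \<open>H\<close> opened by Avoider, Enforcer moves last. The role of
  second-to-last player is reduced to this one by \<open>wins_Enforcer_pass\<close> on even boards
  and by \<open>wins_Enforcer_unpick\<close> on odd ones.\<close>

lemma has_outcome_E_if_even:
  assumes w: "wins (edges G) Enforcer Avoider H {}" and H: "H \<subseteq> verts G" "finite (verts G)"
    and even: "even (card H)"
  shows "has_outcome G \<E>"
proof -
  let ?V = "verts G"
  have "card ?V = card (?V - H) + card H"
    using H by (metis card_Diff_subset card_mono finite_subset le_add_diff_inverse2)
  then have par: "odd (card ?V) \<longleftrightarrow> odd (card (?V - H))" using even by simp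
  have "wins_as_last G Enforcer"
    using wins_Enforcer_superset[OF w H] wins_Enforcer_superset_odd_diff[OF w H] H(2) par
    by (intro wins_imp_wins_as_last) simp_all
  moreover have "wins_as_second_to_last G Enforcer"
  proof (rule wins_imp_wins_as_second_to_last)
    show "wins (edges G) Enforcer (if odd (card ?V) then opponent Enforcer else Enforcer) ?V {}"
    proof (cases "odd (card ?V)")
      case False
      then show ?thesis
        using wins_Enforcer_pass[OF H(2)] wins_Enforcer_superset[OF w H] par by simp
    next
      case True
      then have "?V - H \<noteq> {}" using par by (metis card.empty even_zero)
      then obtain x where x: "x \<in> ?V - H" by blast
      have "?V - {x} - H = ?V - H - {x}" by auto
      moreover have "card (?V - H) = Suc (card (?V - H - {x}))" "card ?V = Suc (card (?V - {x}))"
        using x H(2) by (intro card_Suc_Diff1[symmetric]; auto)+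
      ultimately have ev: "even (card (?V - {x} - H))" "even (card (?V - {x}))"
        using par True by simp_all
      then have "wins (edges G) Enforcer Avoider (?V - {x}) {}"
        using x H by (intro wins_Enforcer_superset[OF w]) auto
      \<comment> \<open>By monotonicity Avoider may be credited with \<open>x\<close>; un-picking it
        then restores the full board with Avoider still to move.\<close>
      then have "wins (edges G) Enforcer Avoider (?V - {x}) {x}"
        by (rule wins_Enforcer_mono) (use H(2) in auto)
      then have "wins (edges G) Enforcer Avoider (insert x (?V - {x})) {}"
        using ev H(2) by (intro wins_Enforcer_unpick[of "?V - {x}"]) auto
      moreover have "insert x (?V - {x}) = ?V" using x by auto
      ultimately show ?thesis using True by simp
    qed
  qed
  ultimately show ?thesis by simp
qed

section \<open>Avoider\<close>

text \<open>If all members of \<open>E\<close> have two elements, this says that the edges inside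
  \<open>W\<close> form a matching.\<close>

definition p3_free :: "'a set set \<Rightarrow> 'a set \<Rightarrow> bool" where
  "p3_free E W \<longleftrightarrow> (\<forall>u\<in>W. \<forall>v\<in>W. \<forall>w\<in>W. {u, v} \<in> E \<longrightarrow> {v, w} \<in> E \<longrightarrow> u = w)"

lemma p3_freeD: "p3_free E W \<Longrightarrow> u \<in> W \<Longrightarrow> v \<in> W \<Longrightarrow> w \<in> W \<Longrightarrow> {u, v} \<in> E \<Longrightarrow> {v, w} \<in> E \<Longrightarrow> u = w"
  by (simp add: p3_free_def)

lemma p3_free_subset: "p3_free E W \<Longrightarrow> X \<subseteq> W \<Longrightarrow> p3_free E X"
  unfolding p3_free_def by blast

text \<open>Matched vertices come in pairs, so a set of odd size has an unmatched one, which is a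
  safe pick for Avoider.\<close>

lemma p3_free_isolated:
  assumes "\<And>e. e \<in> E \<Longrightarrow> card e = 2" "p3_free E W" "finite W" "odd (card W)"
  shows "\<exists>y\<in>W. \<forall>z\<in>W. {y, z} \<notin> E"
  using assms(2-)
proof (induction "card W" arbitrary: W rule: less_induct)
  case less
  then have "W \<noteq> {}" by (metis card.empty even_zero)
  then obtain y where y: "y \<in> W" by blast
  show ?case
  proof (cases "\<forall>z\<in>W. {y, z} \<notin> E")
    case True
    then show ?thesis using y by blast
  next
    case False
    then obtain z where z: "z \<in> W" "{y, z} \<in> E" by blast
    then have "y \<noteq> z" using assms(1)[of "{y, z}"] by auto
    have "card W = Suc (card (W - {y}))" "card (W - {y}) = Suc (card (W - {y} - {z}))"
      using y z \<open>y \<noteq> z\<close> less.prems(2) by (intro card_Suc_Diff1[symmetric]; auto)+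
    then have "card (W - {y} - {z}) < card W" "odd (card (W - {y} - {z}))" using less.prems by auto
    moreover have "p3_free E (W - {y} - {z})" using less.prems(1) by (rule p3_free_subset) auto
    ultimately obtain u where u: "u \<in> W - {y} - {z}" "\<forall>z\<in>W - {y} - {z}. {u, z} \<notin> E"
      using less.hyps[of "W - {y} - {z}"] less.prems(2) by auto
    have "u \<in> W" "u \<noteq> y" "u \<noteq> z" "{z, y} \<in> E" using u z(2) by (auto simp: insert_commute)
    then have "{u, y} \<notin> E" "{u, z} \<notin> E"
      using p3_freeD[OF less.prems(1), of u y z] p3_freeD[OF less.prems(1), of u z y] y z by blast+
    with u show ?thesis by blast
  qed
qed

text \<open>\<open>l\<close> is the partner of \<open>y\<close>; if there is none, any other vertex
  will do, and one exists because \<open>W\<close> is even. Avoider will pick \<open>y\<close> and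
  reserve \<open>l\<close> for Enforcer.\<close>

lemma p3_free_unique_neighbour:
  assumes "p3_free E W" "finite W" "even (card W)" "y \<in> W"
  shows "\<exists>l\<in>W - {y}. \<forall>z\<in>W - {y} - {l}. {y, z} \<notin> E"
proof (cases "\<exists>l\<in>W - {y}. {y, l} \<in> E")
  case True
  then obtain l where "l \<in> W - {y}" "{y, l} \<in> E" by blast
  then show ?thesis
    using p3_freeD[OF assms(1), of l y] assms(4) by (intro bexI[of _ l]) (auto simp: insert_commute)
next
  case False
  have "card W = Suc (card (W - {y}))" using assms by (intro card_Suc_Diff1[symmetric]) auto
  then have "W - {y} \<noteq> {}" using assms(3) by (metis card.empty odd_one One_nat_def)
  then show ?thesis using False by blast
qed

lemma no_edge_subset:
  assumes "\<And>e. e \<in> E \<Longrightarrow> card e = 2" "\<And>a b. a \<in> A \<Longrightarrow> b \<in> A \<Longrightarrow> {a, b} \<notin> E"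
  shows "\<forall>e\<in>E. \<not> e \<subseteq> A"
proof (intro ballI notI)
  fix e assume e: "e \<in> E" "e \<subseteq> A"
  then obtain a b where "e = {a, b}" using assms(1) by (metis card_2_iff)
  then show False using e assms(2) by blast
qed

text \<open>The vertices outside \<open>L\<close> can be paired up along the edges; Avoider never takes both
  vertices of a pair and leaves the vertex in \<open>L\<close> to Enforcer.\<close>

lemma wins_Avoider_pairing:
  assumes card2: "\<And>e. e \<in> E \<Longrightarrow> card e = 2"
    and "finite U" "L \<subseteq> U" "\<And>x y. x \<in> L \<Longrightarrow> y \<in> L \<Longrightarrow> x = y"
    and "even (card (U - L))" "p3_free E (U - L)"
    and "\<And>a x. a \<in> A \<Longrightarrow> x \<in> A \<union> (U - L) \<Longrightarrow> {a, x} \<notin> E"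
  shows "wins E Avoider Enforcer U A"
  using assms(2-)
proof (induction "card U" arbitrary: U L A rule: less_induct)
  case less
  note prems = less.prems
  show ?case
  proof (rule wins_Avoider_EnforcerI)
    show "\<forall>e\<in>E. \<not> e \<subseteq> A" by (rule no_edge_subset[OF card2]) (use prems(6) in auto)
    fix v assume v: "v \<in> U"
    have smaller: "card (U - {v} - {y}) < card U" for y
      using v prems(1) by (intro psubset_card_mono) auto
    show "wins E Avoider Avoider (U - {v}) A"
    proof (cases "v \<in> L")
      \<comment> \<open>Enforcer took the reserved vertex. Avoider may take any \<open>y\<close>
        that is left and reserves its partner \<open>l\<close> instead.\<close>
      case True
      then have L: "U - L = U - {v}" using prems(3) by blast
      show ?thesis
      proof (cases "U - {v} = {}")
        case True
        then show ?thesis using \<open>\<forall>e\<in>E. \<not> e \<subseteq> A\<close> unfolding True wins_empty_iff by simp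
      next
        case False
        then obtain y where y: "y \<in> U - {v}" by blast
        have "p3_free E (U - {v})" "finite (U - {v})" "even (card (U - {v}))"
          using prems(1,4,5) unfolding L by auto
        from p3_free_unique_neighbour[OF this y]
        obtain l where l: "l \<in> U - {v} - {y}" "\<And>z. z \<in> U - {v} - {y} - {l} \<Longrightarrow> {y, z} \<notin> E"
          by blast
        have "card (U - {v}) = Suc (card (U - {v} - {y}))"
          "card (U - {v} - {y}) = Suc (card (U - {v} - {y} - {l}))"
          using y l prems(1) by (intro card_Suc_Diff1[symmetric]; auto)+
        then have "even (card (U - {v} - {y} - {l}))" using prems(4) L by simp
        moreover have "p3_free E (U - {v} - {y} - {l})"
          using prems(5) unfolding L by (rule p3_free_subset) auto
        moreover have "{a, x} \<notin> E" if "a \<in> insert y A" "x \<in> insert y A \<union> (U - {v} - {y} - {l})" for a x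
        proof
          assume e: "{a, x} \<in> E"
          then have "{x, a} \<in> E" "a \<noteq> x" using card2[OF e] by (auto simp: insert_commute)
          then show False
            using e that l(2)[of x] prems(6)[of a x] prems(6)[of x a] y unfolding L by blast
        qed
        ultimately have "wins E Avoider Enforcer (U - {v} - {y}) (insert y A)"
          using smaller prems(1) l(1) by (intro less.hyps[of _ "{l}"]) auto
        then show ?thesis by (rule wins_Avoider_AvoiderI[OF y])
      qed
    next
      \<comment> \<open>An odd number of vertices is left outside \<open>L\<close>, so one of them
        is unmatched; Avoider takes it and \<open>L\<close> stays reserved.\<close>
      case False
      have "card (U - L) = Suc (card (U - L - {v}))"
        using v False prems(1) by (intro card_Suc_Diff1[symmetric]) auto
      then have "odd (card (U - L - {v}))" using prems(4) by simp
      moreover have "p3_free E (U - L - {v})" using prems(5) by (rule p3_free_subset) auto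
      ultimately obtain y where y: "y \<in> U - L - {v}" "\<And>z. z \<in> U - L - {v} \<Longrightarrow> {y, z} \<notin> E"
        using p3_free_isolated[OF card2] prems(1) by (metis finite_Diff)
      have "card (U - L - {v}) = Suc (card (U - L - {v} - {y}))"
        using y prems(1) by (intro card_Suc_Diff1[symmetric]) auto
      then have "even (card (U - L - {v} - {y}))" using \<open>odd (card (U - L - {v}))\<close> by simp
      moreover have eq: "U - L - {v} - {y} = U - {v} - {y} - L" by auto
      moreover have "p3_free E (U - {v} - {y} - L)" using prems(5) by (rule p3_free_subset) auto
      moreover have "{a, x} \<notin> E" if "a \<in> insert y A" "x \<in> insert y A \<union> (U - {v} - {y} - L)" for a x
      proof
        assume e: "{a, x} \<in> E"
        then have "{x, a} \<in> E" "a \<noteq> x" using card2[OF e] by (auto simp: insert_commute)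
        then show False
          using e that y(1) y(2)[of x] prems(6)[of a x] prems(6)[of x a] by blast
      qed
      moreover have "L \<subseteq> U - {v} - {y}" using prems(2) False y by auto
      ultimately have "wins E Avoider Enforcer (U - {v} - {y}) (insert y A)"
        using smaller prems(1,3) by (intro less.hyps[of _ L]) auto
      then show ?thesis using y by (intro wins_Avoider_AvoiderI[of y]) auto
    qed
  qed
qed

section \<open>Play around a closed set of five vertices\<close>

text \<open>A graph on four vertices with minimum degree at least 2 contains a 4-cycle. Hence some
  \<open>y\<close> has no neighbour except possibly one vertex \<open>l\<close>.\<close>

lemma four_vertices_no_C4:
  assumes "card S = 4"
    and noC4: "\<And>a b c d. {a, b, c, d} \<subseteq> S \<Longrightarrow> distinct [a, b, c, d] \<Longrightarrow>
      {a, b} \<in> E \<Longrightarrow> {b, c} \<in> E \<Longrightarrow> {c, d} \<in> E \<Longrightarrow> {d, a} \<in> E \<Longrightarrow> False"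
  shows "\<exists>y\<in>S. \<exists>l\<in>S - {y}. \<forall>z\<in>S - {y} - {l}. {y, z} \<notin> E"
proof -
  obtain p q r s where S: "S = {p, q, r, s}" and d: "distinct [p, q, r, s]"
    using assms(1) by (auto simp: card_Suc_eq numeral_eq_Suc)
  \<comment> \<open>Fixing one order for each pair leaves six propositional atoms, and the claim
    becomes a finite case check.\<close>
  have c: "{q, p} = {p, q}" "{r, p} = {p, r}" "{s, p} = {p, s}"
    "{r, q} = {q, r}" "{s, q} = {q, s}" "{s, r} = {r, s}" by auto
  \<comment> \<open>These are the three 4-cycles on a set of four vertices.\<close>
  have "\<not> ({p, q} \<in> E \<and> {q, r} \<in> E \<and> {r, s} \<in> E \<and> {p, s} \<in> E)"
    "\<not> ({p, r} \<in> E \<and> {q, r} \<in> E \<and> {q, s} \<in> E \<and> {p, s} \<in> E)"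
    "\<not> ({p, q} \<in> E \<and> {q, s} \<in> E \<and> {r, s} \<in> E \<and> {p, r} \<in> E)"
    using noC4[of p q r s] noC4[of p r q s] noC4[of p q s r] d c unfolding S by auto
  moreover have "S - {p} - {q} = {r, s}" "S - {p} - {r} = {q, s}" "S - {p} - {s} = {q, r}"
    "S - {q} - {p} = {r, s}" "S - {q} - {r} = {p, s}" "S - {q} - {s} = {p, r}"
    "S - {r} - {p} = {q, s}" "S - {r} - {q} = {p, s}" "S - {r} - {s} = {p, q}"
    "S - {s} - {p} = {q, r}" "S - {s} - {q} = {p, r}" "S - {s} - {r} = {p, q}"
    using d unfolding S by auto
  moreover have "S - {p} = {q, r, s}" "S - {q} = {p, r, s}" "S - {r} = {p, q, s}" "S - {s} = {p, q, r}"
    using d unfolding S by auto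
  ultimately show ?thesis using c by (auto simp: S)
qed

text \<open>Once Enforcer has taken a vertex of \<open>B\<close>, one of the other four has at most one
  neighbour left; Avoider takes it and leaves that neighbour to Enforcer.\<close>

lemma wins_Avoider_closed_5_set:
  assumes card2: "\<And>e. e \<in> E \<Longrightarrow> card e = 2"
    and "card B = 5"
    and noC4: "\<And>a b c d. distinct [a, b, c, d] \<Longrightarrow>
      {a, b} \<in> E \<Longrightarrow> {b, c} \<in> E \<Longrightarrow> {c, d} \<in> E \<Longrightarrow> {d, a} \<in> E \<Longrightarrow> False"
    and closed: "\<And>x y. x \<in> B \<Longrightarrow> {x, y} \<in> E \<Longrightarrow> y \<in> B"
    and "finite U" "B \<subseteq> U" "even (card (U - B))" "p3_free E (U - B)"
    and "\<And>a x. a \<in> A \<Longrightarrow> x \<in> A \<union> U \<Longrightarrow> {a, x} \<notin> E"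
  shows "wins E Avoider Enforcer U A"
  using assms(5-)
proof (induction "card U" arbitrary: U A rule: less_induct)
  case less
  note prems = less.prems
  show ?case
  proof (rule wins_Avoider_EnforcerI)
    show "\<forall>e\<in>E. \<not> e \<subseteq> A" by (rule no_edge_subset[OF card2]) (use prems(5) in auto)
    fix v assume v: "v \<in> U"
    have smaller: "card (U - {v} - {y}) < card U" for y
      using v prems(1) by (intro psubset_card_mono) auto
    show "wins E Avoider Avoider (U - {v}) A"
    proof (cases "v \<in> B")
      case True
      have fB: "finite B" using prems finite_subset by blast
      then have c4: "card (B - {v}) = 4" using True assms(2) by simp
      have "\<exists>y\<in>B - {v}. \<exists>l\<in>B - {v} - {y}. \<forall>z\<in>B - {v} - {y} - {l}. {y, z} \<notin> E"
        by (rule four_vertices_no_C4[OF c4]) (rule noC4)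
      then obtain y l where yl: "y \<in> B - {v}" "l \<in> B - {v} - {y}"
        "\<And>z. z \<in> B - {v} - {y} - {l} \<Longrightarrow> {y, z} \<notin> E" by blast
      have "card (B - {v} - {y} - {l}) = 2" using c4 yl fB by simp
      \<comment> \<open>Besides \<open>l\<close> only two vertices of \<open>B\<close> remain free;
        adjacent or not, they do not spoil the matching.\<close>
      then obtain p q where pq: "B - {v} - {y} - {l} = {p, q}" "p \<noteq> q" by (auto simp: card_2_iff)
      have eq: "U - {v} - {y} - {l} = (U - B) \<union> {p, q}"
        using pq yl True prems(2) by blast
      have "wins E Avoider Enforcer (U - {v} - {y}) (insert y A)"
      proof (rule wins_Avoider_pairing[where L = "{l}"])
        have "p \<in> B" "q \<in> B" using pq by auto
        then have "card ((U - B) \<union> {p, q}) = card (U - B) + 2"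
          using prems(1) pq by (subst card_Un_disjoint) auto
        then show "even (card (U - {v} - {y} - {l}))" unfolding eq using prems(3) by simp
        show "p3_free E (U - {v} - {y} - {l})"
          unfolding p3_free_def
        proof (intro ballI impI)
          fix a b c assume abc: "a \<in> U - {v} - {y} - {l}" "b \<in> U - {v} - {y} - {l}"
            "c \<in> U - {v} - {y} - {l}" "{a, b} \<in> E" "{b, c} \<in> E"
          have ne: "a \<noteq> b" "b \<noteq> c" using card2[OF abc(4)] card2[OF abc(5)] by auto
          \<comment> \<open>By \<open>closed\<close> a path lies entirely inside or entirely outside
            \<open>B\<close>; inside, only \<open>p\<close> and \<open>q\<close> are available, so
            its ends agree.\<close>
          have "a \<in> B \<longleftrightarrow> b \<in> B" "b \<in> B \<longleftrightarrow> c \<in> B"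
            using abc(4,5) closed by (metis insert_commute)+
          moreover have "a = c" if "a \<notin> B" "b \<notin> B" "c \<notin> B"
            using p3_freeD[OF prems(4)] that abc by blast
          moreover have "a = c" if "a \<in> B" "b \<in> B" "c \<in> B"
            using that abc(1-3) ne unfolding eq by auto
          ultimately show "a = c" by blast
        qed
        show "{a, x} \<notin> E" if "a \<in> insert y A" "x \<in> insert y A \<union> (U - {v} - {y} - {l})" for a x
        proof
          assume e: "{a, x} \<in> E"
          then have "{x, a} \<in> E" "a \<noteq> x" using card2[OF e] by (auto simp: insert_commute)
          then show False
            using e that yl(1) yl(3)[of x] closed[of y x] prems(2) prems(5)[of a x] prems(5)[of x a]
            by blast
        qed
      qed (use card2 prems(1,2) yl in auto)
      then show ?thesis using yl prems(2) by (intro wins_Avoider_AvoiderI[of y]) auto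
    next
      \<comment> \<open>Enforcer played outside \<open>B\<close>, where an odd number of vertices is
        left. An unmatched one has no neighbour in \<open>B\<close> either, by
        \<open>closed\<close>.\<close>
      case False
      have "card (U - B) = Suc (card (U - B - {v}))"
        using v False prems(1) by (intro card_Suc_Diff1[symmetric]) auto
      then have "odd (card (U - B - {v}))" using prems(3) by simp
      moreover have "p3_free E (U - B - {v})" using prems(4) by (rule p3_free_subset) auto
      ultimately obtain y where y: "y \<in> U - B - {v}" "\<And>z. z \<in> U - B - {v} \<Longrightarrow> {y, z} \<notin> E"
        using p3_free_isolated[OF card2] prems(1) by (metis finite_Diff)
      have "card (U - B - {v}) = Suc (card (U - B - {v} - {y}))"
        using y prems(1) by (intro card_Suc_Diff1[symmetric]) auto
      then have "even (card (U - B - {v} - {y}))" using \<open>odd (card (U - B - {v}))\<close> by simp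
      moreover have eq: "U - B - {v} - {y} = U - {v} - {y} - B" by auto
      moreover have "p3_free E (U - {v} - {y} - B)" using prems(4) by (rule p3_free_subset) auto
      moreover have "{a, x} \<notin> E" if "a \<in> insert y A" "x \<in> insert y A \<union> (U - {v} - {y})" for a x
      proof
        assume e: "{a, x} \<in> E"
        then have "{x, a} \<in> E" "a \<noteq> x" using card2[OF e] by (auto simp: insert_commute)
        then show False
          using e that y(1) y(2)[of x] closed[of x a] prems(5)[of a x] prems(5)[of x a] by blast
      qed
      moreover have "B \<subseteq> U - {v} - {y}" using prems(2) False y by auto
      ultimately have "wins E Avoider Enforcer (U - {v} - {y}) (insert y A)"
        using smaller prems(1) by (intro less.hyps) auto
      then show ?thesis using y by (intro wins_Avoider_AvoiderI[of y]) auto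
    qed
  qed
qed

section \<open>Outcomes secured by Avoider\<close>

text \<open>The pairing play starts with Enforcer to move. If Avoider opens, the first pick is an
  isolated vertex on an odd board, and any vertex with its partner reserved on a nonempty even
  one.\<close>

lemma has_outcome_A_if_p3_free:
  assumes G: "simple_graph G" and free: "p3_free (edges G) (verts G)"
  shows "has_outcome G \<A>"
proof -
  let ?V = "verts G" and ?E = "edges G"
  have card2: "\<And>e. e \<in> ?E \<Longrightarrow> card e = 2" and fin: "finite ?V"
    using G by (auto simp: simple_graph_def)
  have loop: "{a, a} \<notin> ?E" for a using card2[of "{a, a}"] by auto
  have par: "even (card (X - {y})) \<longleftrightarrow> odd (card X)" if "y \<in> X" "X \<subseteq> ?V" for y X
    using that card_Suc_Diff1[of X y] fin finite_subset by (metis even_Suc)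
  have first: "wins ?E Avoider Avoider ?V {}"
    if "y \<in> ?V" "L \<subseteq> ?V - {y}" "\<And>a b. a \<in> L \<Longrightarrow> b \<in> L \<Longrightarrow> a = b" "even (card (?V - {y} - L))"
      "\<And>z. z \<in> ?V - {y} - L \<Longrightarrow> {y, z} \<notin> ?E" for y L
  proof (rule wins_Avoider_AvoiderI[OF that(1)])
    show "wins ?E Avoider Enforcer (?V - {y}) {y}"
    proof (rule wins_Avoider_pairing[where L = L])
      show "p3_free ?E (?V - {y} - L)" using free by (rule p3_free_subset) auto
    qed (use that fin card2 loop in auto)
  qed
  have "wins_as_last G Avoider"
  proof (rule wins_imp_wins_as_last)
    show "wins ?E Avoider (if odd (card ?V) then Avoider else opponent Avoider) ?V {}"
    proof (cases "odd (card ?V)")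
      case True
      obtain y where y: "y \<in> ?V" "\<forall>z\<in>?V. {y, z} \<notin> ?E"
        using p3_free_isolated[OF card2 free fin True] by blast
      have "even (card (?V - {y} - {}))" using par[OF y(1)] True by simp
      then have "wins ?E Avoider Avoider ?V {}"
        by (intro first[of y "{}"]) (use y in simp_all)
      then show ?thesis using True by simp
    next
      case False
      have "wins ?E Avoider Enforcer ?V {}"
        by (rule wins_Avoider_pairing[where L = "{}"]) (use card2 fin free False in simp_all)
      then show ?thesis using False by simp
    qed
  qed
  moreover have "wins_as_second_to_last G Avoider"
  proof (rule wins_imp_wins_as_second_to_last)
    show "wins ?E Avoider (if odd (card ?V) then opponent Avoider else Avoider) ?V {}"
    proof (cases "odd (card ?V)")
      case True
      then have "?V \<noteq> {}" by (metis card.empty even_zero)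
      then obtain y where y: "y \<in> ?V" by blast
      have "p3_free ?E (?V - {y})" using free by (rule p3_free_subset) auto
      moreover have "even (card (?V - {y}))" using par[OF y] True by simp
      \<comment> \<open>Reserving an arbitrary \<open>y\<close> for Enforcer makes the number of
        remaining vertices even.\<close>
      ultimately have "wins ?E Avoider Enforcer ?V {}"
        by (intro wins_Avoider_pairing[where L = "{y}"]) (use card2 fin y in simp_all)
      then show ?thesis using True by simp
    next
      case False
      have "wins ?E Avoider Avoider ?V {}"
      proof (cases "?V = {}")
        case True
        have "\<not> e \<subseteq> {}" if "e \<in> ?E" for e using card2[OF that] by auto
        then show ?thesis unfolding True wins_empty_iff by simp
      next
        case False
        then obtain y where y: "y \<in> ?V" by blast
        have "even (card ?V)" using \<open>\<not> odd (card ?V)\<close> by simp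
        then obtain l where l: "l \<in> ?V - {y}" "\<forall>z\<in>?V - {y} - {l}. {y, z} \<notin> ?E"
          using p3_free_unique_neighbour[OF free fin _ y] by blast
        have "even (card (?V - {y} - {l}))"
          using par[OF y] par[OF l(1)] \<open>even (card ?V)\<close> by blast
        then show ?thesis by (intro first[of y "{l}"]) (use y l in simp_all)
      qed
      then show ?thesis using False by simp
    qed
  qed
  ultimately show ?thesis by simp
qed

text \<open>The vertex \<open>c\<close> is reserved for Enforcer. If Avoider has to open, a vertex
  unmatched in the rest is safe, since its only possible neighbour is \<open>c\<close>.\<close>

lemma wins_as_second_to_last_Avoider_if_hit:
  assumes G: "simple_graph G" and c: "c \<in> verts G" and free: "p3_free (edges G) (verts G - {c})"
  shows "wins_as_second_to_last G Avoider"
proof -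
  let ?V = "verts G" and ?E = "edges G"
  have card2: "\<And>e. e \<in> ?E \<Longrightarrow> card e = 2" and fin: "finite ?V"
    using G by (auto simp: simple_graph_def)
  have loop: "{a, a} \<notin> ?E" for a using card2[of "{a, a}"] by auto
  have par: "even (card (X - {y})) \<longleftrightarrow> odd (card X)" if "y \<in> X" "X \<subseteq> ?V" for y X
    using that card_Suc_Diff1[of X y] fin finite_subset by (metis even_Suc)
  show ?thesis
  proof (rule wins_imp_wins_as_second_to_last)
    show "wins ?E Avoider (if odd (card ?V) then opponent Avoider else Avoider) ?V {}"
    proof (cases "odd (card ?V)")
      case True
      have "even (card (?V - {c}))" using par[OF c] True by simp
      then have "wins ?E Avoider Enforcer ?V {}"
        by (intro wins_Avoider_pairing[where L = "{c}"]) (use card2 fin c free in simp_all)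
      then show ?thesis using True by simp
    next
      case False
      then have odd: "odd (card (?V - {c}))" using par[OF c] by blast
      obtain y where y: "y \<in> ?V - {c}" "\<forall>z\<in>?V - {c}. {y, z} \<notin> ?E"
        using p3_free_isolated[OF card2 free _ odd] fin by blast
      have "wins ?E Avoider Enforcer (?V - {y}) {y}"
      proof (rule wins_Avoider_pairing[where L = "{c}"])
        have eq: "?V - {y} - {c} = ?V - {c} - {y}" by auto
        show "even (card (?V - {y} - {c}))" unfolding eq using par[OF y(1)] odd by blast
        show "p3_free ?E (?V - {y} - {c})" using free by (rule p3_free_subset) auto
      qed (use y fin c card2 loop in auto)
      then have "wins ?E Avoider Avoider ?V {}" using y by (intro wins_Avoider_AvoiderI[of y]) auto
      then show ?thesis using False by simp
    qed
  qed
qed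

text \<open>As \<open>B\<close> has odd size, Enforcer opens exactly when an even number of vertices
  lies outside \<open>B\<close>, and \<open>wins_Avoider_closed_5_set\<close> applies at once;
  otherwise Avoider first takes an unmatched vertex outside \<open>B\<close>.\<close>

lemma wins_as_second_to_last_Avoider_if_closed:
  assumes G: "simple_graph G"
    and noC4: "\<And>a b c d. distinct [a, b, c, d] \<Longrightarrow> {a, b} \<in> edges G \<Longrightarrow> {b, c} \<in> edges G
      \<Longrightarrow> {c, d} \<in> edges G \<Longrightarrow> {d, a} \<in> edges G \<Longrightarrow> False"
    and B: "B \<subseteq> verts G" "card B = 5" "\<And>x y. x \<in> B \<Longrightarrow> {x, y} \<in> edges G \<Longrightarrow> y \<in> B"
    and free: "p3_free (edges G) (verts G - B)"
  shows "wins_as_second_to_last G Avoider"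
proof -
  let ?V = "verts G" and ?E = "edges G"
  have card2: "\<And>e. e \<in> ?E \<Longrightarrow> card e = 2" and fin: "finite ?V"
    using G by (auto simp: simple_graph_def)
  have loop: "{a, a} \<notin> ?E" for a using card2[of "{a, a}"] by auto
  have "card ?V = card (?V - B) + card B"
    using fin B(1) by (metis card_Diff_subset card_mono finite_subset le_add_diff_inverse2)
  then have par: "odd (card ?V) \<longleftrightarrow> even (card (?V - B))" using B(2) by simp
  show ?thesis
  proof (rule wins_imp_wins_as_second_to_last)
    show "wins ?E Avoider (if odd (card ?V) then opponent Avoider else Avoider) ?V {}"
    proof (cases "odd (card ?V)")
      case True
      have "wins ?E Avoider Enforcer ?V {}"
        by (rule wins_Avoider_closed_5_set[of _ B])
          (use card2 B fin free True par noC4 in \<open>auto simp del: distinct.simps\<close>)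
      then show ?thesis using True by simp
    next
      case False
      then have odd: "odd (card (?V - B))" using par by simp
      obtain y where y: "y \<in> ?V - B" "\<forall>z\<in>?V - B. {y, z} \<notin> ?E"
        using p3_free_isolated[OF card2 free _ odd] fin by blast
      have out: "{y, z} \<notin> ?E" if "z \<in> ?V" for z
        using that y B(3)[of z y] by (auto simp: insert_commute)
      have "wins ?E Avoider Enforcer (?V - {y}) {y}"
      proof (rule wins_Avoider_closed_5_set[of _ B])
        have eq: "?V - {y} - B = ?V - B - {y}" by auto
        have "card (?V - B) = Suc (card (?V - B - {y}))"
          using y fin by (intro card_Suc_Diff1[symmetric]) auto
        then show "even (card (?V - {y} - B))" unfolding eq using odd by simp
        show "p3_free ?E (?V - {y} - B)" using free by (rule p3_free_subset) auto
        show "False" if "distinct [a, b, c, d]" "{a, b} \<in> ?E" "{b, c} \<in> ?E" "{c, d} \<in> ?E" "{d, a} \<in> ?E"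
          for a b c d by (rule noC4[OF that])
      qed (use y out fin B card2 loop in auto)
      then have "wins ?E Avoider Avoider ?V {}" using y by (intro wins_Avoider_AvoiderI[of y]) auto
      then show ?thesis using False by simp
    qed
  qed
qed

section \<open>Forbidden subgraphs\<close>

lemma contains_subgraph_iff:
  assumes H: "simple_graph H"
  shows "contains_subgraph G H \<longleftrightarrow>
    (\<exists>f. inj_on f (verts H) \<and> f ` verts H \<subseteq> verts G \<and> (\<forall>e\<in>edges H. f ` e \<in> edges G))"
proof
  assume "contains_subgraph G H"
  then show "\<exists>f. inj_on f (verts H) \<and> f ` verts H \<subseteq> verts G \<and> (\<forall>e\<in>edges H. f ` e \<in> edges G)"
    unfolding contains_subgraph_def isomorphic_def subgraph_def bij_betw_def
    by (elim exE conjE) (rule exI, auto)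
next
  assume "\<exists>f. inj_on f (verts H) \<and> f ` verts H \<subseteq> verts G \<and> (\<forall>e\<in>edges H. f ` e \<in> edges G)"
  then obtain f where f: "inj_on f (verts H)" "f ` verts H \<subseteq> verts G"
    "\<forall>e\<in>edges H. f ` e \<in> edges G" by blast
  let ?H = "\<lparr>verts = f ` verts H, edges = (\<lambda>e. f ` e) ` edges H\<rparr>"
  have "card (f ` e) = 2" if "e \<in> edges H" for e
    using that H card_image[OF inj_on_subset[OF f(1)], of e] by (auto simp: simple_graph_def)
  then have "simple_graph ?H" using H by (auto simp: simple_graph_def)
  moreover have "subgraph ?H G" using f by (auto simp: subgraph_def)
  moreover have "isomorphic H ?H"
    using f(1) by (auto simp: isomorphic_def bij_betw_def intro!: exI[of _ f])
  ultimately show "contains_subgraph G H" unfolding contains_subgraph_def by blast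
qed

lemma path_graph_3: "verts (path_graph 3) = {0, 1, 2}" "edges (path_graph 3) = {{0, 1}, {1, 2}}"
proof -
  have "Suc i < 3 \<longleftrightarrow> i = 0 \<or> i = 1" for i by auto
  then show "edges (path_graph 3) = {{0, 1}, {1, 2}}"
    by (auto simp: path_graph_def numeral_eq_Suc)
qed (auto simp: path_graph_def)

lemma cycle_graph_3: "verts (cycle_graph 3) = {0, 1, 2}" "edges (cycle_graph 3) = {{0, 1}, {1, 2}, {2, 0}}"
proof -
  have "i < 3 \<longleftrightarrow> i = 0 \<or> i = 1 \<or> i = 2" for i :: nat by auto
  then have "edges (cycle_graph 3) = {{i, Suc i mod 3} | i. i = 0 \<or> i = 1 \<or> i = 2}"
    by (simp add: cycle_graph_def)
  also have "\<dots> = (\<lambda>i. {i, Suc i mod 3}) ` {0, 1, 2}" by blast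
  also have "\<dots> = {{0, 1}, {1, 2}, {2, 0}}" by (simp flip: numeral_2_eq_2)
  finally show "edges (cycle_graph 3) = {{0, 1}, {1, 2}, {2, 0}}" .
qed (auto simp: cycle_graph_def)

lemma cycle_graph_4: "verts (cycle_graph 4) = {0, 1, 2, 3}"
  "edges (cycle_graph 4) = {{0, 1}, {1, 2}, {2, 3}, {3, 0}}"
proof -
  have "i < 4 \<longleftrightarrow> i = 0 \<or> i = 1 \<or> i = 2 \<or> i = 3" for i :: nat by auto
  then have "edges (cycle_graph 4) = {{i, Suc i mod 4} | i. i = 0 \<or> i = 1 \<or> i = 2 \<or> i = 3}"
    by (simp add: cycle_graph_def)
  also have "\<dots> = (\<lambda>i. {i, Suc i mod 4}) ` {0, 1, 2, 3}" by blast
  also have "\<dots> = {{0, 1}, {1, 2}, {2, 3}, {3, 0}}" by (simp flip: numeral_2_eq_2)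
  finally show "edges (cycle_graph 4) = {{0, 1}, {1, 2}, {2, 3}, {3, 0}}" .
qed (auto simp: cycle_graph_def)

lemma two_path_graph_3:
  "verts (disjoint_union (path_graph 3) (path_graph 3)) = {Inl 0, Inl 1, Inl 2, Inr 0, Inr 1, Inr 2}"
  "edges (disjoint_union (path_graph 3) (path_graph 3)) =
    {{Inl 0, Inl 1}, {Inl 1, Inl 2}, {Inr 0, Inr 1}, {Inr 1, Inr 2}}"
  by (simp_all add: disjoint_union_def path_graph_3 Plus_def insert_commute)

lemma sunlet_3:
  "verts (sunlet 3) = {Inl 0, Inl 1, Inl 2, Inr 0, Inr 1, Inr 2}"
  "edges (sunlet 3) = {{Inl 0, Inl 1}, {Inl 1, Inl 2}, {Inl 2, Inl 0},
    {Inl 0, Inr 0}, {Inl 1, Inr 1}, {Inl 2, Inr 2}}"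
proof -
  have *: "{..<3} = {0, 1, 2::nat}" by auto
  then show "verts (sunlet 3) = {Inl 0, Inl 1, Inl 2, Inr 0, Inr 1, Inr 2}"
    by (simp add: sunlet_def Plus_def insert_commute)
  have "{{Inl i, Inr i} | i. i < 3} = (\<lambda>i. {Inl i, Inr i}) ` {..<3::nat}" by blast
  then show "edges (sunlet 3) = {{Inl 0, Inl 1}, {Inl 1, Inl 2}, {Inl 2, Inl 0},
    {Inl 0, Inr 0}, {Inl 1, Inr 1}, {Inl 2, Inr 2}}"
    by (simp add: sunlet_def cycle_graph_3 * insert_commute)
qed

lemma edge_imp_verts: "simple_graph G \<Longrightarrow> {a, b} \<in> edges G \<Longrightarrow> a \<in> verts G \<and> b \<in> verts G"
  by (auto simp: simple_graph_def)

lemma contains_P3_iff: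
  assumes "simple_graph G"
  shows "contains_subgraph G (path_graph 3) \<longleftrightarrow>
    (\<exists>a b c. distinct [a, b, c] \<and> {a, b} \<in> edges G \<and> {b, c} \<in> edges G)" (is "_ \<longleftrightarrow> ?R")
proof -
  have "simple_graph (path_graph 3)" by (simp add: simple_graph_def path_graph_3)
  note iff = contains_subgraph_iff[OF this, unfolded path_graph_3]
  show ?thesis
  proof
    assume "contains_subgraph G (path_graph 3)"
    then obtain f :: "nat \<Rightarrow> 'a" where "inj_on f {0, 1, 2}" "{f 0, f 1} \<in> edges G" "{f 1, f 2} \<in> edges G"
      unfolding iff by auto
    \<comment> \<open>Injectivity becomes distinctness of the list of images, whose entries are the
      vertices sought.\<close>
    moreover from this(1) have "distinct (map f [0, 1, 2])"
      unfolding distinct_map by simp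
    ultimately show ?R unfolding list.map by blast
  next
    assume ?R
    then obtain a b c where "distinct [a, b, c]" "{a, b} \<in> edges G" "{b, c} \<in> edges G" by blast
    then show "contains_subgraph G (path_graph 3)"
      unfolding iff using edge_imp_verts[OF assms]
      by (intro exI[of _ "\<lambda>i. [a, b, c] ! i"]) auto
  qed
qed

lemma contains_C4_iff:
  assumes "simple_graph G"
  shows "contains_subgraph G (cycle_graph 4) \<longleftrightarrow>
    (\<exists>a b c d. distinct [a, b, c, d] \<and> {a, b} \<in> edges G \<and> {b, c} \<in> edges G \<and> {c, d} \<in> edges G
      \<and> {d, a} \<in> edges G)" (is "_ \<longleftrightarrow> ?R")
proof -
  have "simple_graph (cycle_graph 4)" by (simp add: simple_graph_def cycle_graph_4)
  note iff = contains_subgraph_iff[OF this, unfolded cycle_graph_4]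
  show ?thesis
  proof
    assume "contains_subgraph G (cycle_graph 4)"
    then obtain f :: "nat \<Rightarrow> 'a" where "inj_on f {0, 1, 2, 3}" "{f 0, f 1} \<in> edges G"
      "{f 1, f 2} \<in> edges G" "{f 2, f 3} \<in> edges G" "{f 3, f 0} \<in> edges G"
      unfolding iff by auto
    moreover from this(1) have "distinct (map f [0, 1, 2, 3])"
      unfolding distinct_map by simp
    ultimately show ?R unfolding list.map by blast
  next
    assume ?R
    then obtain a b c d where "distinct [a, b, c, d]" "{a, b} \<in> edges G" "{b, c} \<in> edges G"
      "{c, d} \<in> edges G" "{d, a} \<in> edges G" by blast
    then show "contains_subgraph G (cycle_graph 4)"
      unfolding iff using edge_imp_verts[OF assms]
      by (intro exI[of _ "\<lambda>i. [a, b, c, d] ! i"]) auto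
  qed
qed

lemma contains_2P3_iff:
  assumes "simple_graph G"
  shows "contains_subgraph G (disjoint_union (path_graph 3) (path_graph 3)) \<longleftrightarrow>
    (\<exists>a b c d e f. distinct [a, b, c, d, e, f] \<and> {a, b} \<in> edges G \<and> {b, c} \<in> edges G
      \<and> {d, e} \<in> edges G \<and> {e, f} \<in> edges G)" (is "_ \<longleftrightarrow> ?R")
proof -
  let ?H = "disjoint_union (path_graph 3) (path_graph 3)"
  have "simple_graph ?H" by (simp add: simple_graph_def two_path_graph_3)
  note iff = contains_subgraph_iff[OF this, unfolded two_path_graph_3]
  show ?thesis
  proof
    assume "contains_subgraph G ?H"
    then obtain f :: "nat + nat \<Rightarrow> 'a" where
      "inj_on f {Inl 0, Inl 1, Inl 2, Inr 0, Inr 1, Inr 2}"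
      "{f (Inl 0), f (Inl 1)} \<in> edges G" "{f (Inl 1), f (Inl 2)} \<in> edges G"
      "{f (Inr 0), f (Inr 1)} \<in> edges G" "{f (Inr 1), f (Inr 2)} \<in> edges G"
      unfolding iff by auto
    moreover from this(1) have "distinct (map f [Inl 0, Inl 1, Inl 2, Inr 0, Inr 1, Inr 2])"
      unfolding distinct_map by simp
    ultimately show ?R unfolding list.map by blast
  next
    assume ?R
    then obtain a b c d e f where "distinct [a, b, c, d, e, f]" "{a, b} \<in> edges G" "{b, c} \<in> edges G"
      "{d, e} \<in> edges G" "{e, f} \<in> edges G" by blast
    then show "contains_subgraph G ?H"
      unfolding iff using edge_imp_verts[OF assms]
      by (intro exI[of _ "case_sum (\<lambda>i. [a, b, c] ! i) (\<lambda>i. [d, e, f] ! i)"]) simp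
  qed
qed

lemma contains_3_sunlet_iff:
  assumes "simple_graph G"
  shows "contains_subgraph G (sunlet 3) \<longleftrightarrow>
    (\<exists>x y z x' y' z'. distinct [x, y, z, x', y', z'] \<and> {x, y} \<in> edges G \<and> {y, z} \<in> edges G
      \<and> {z, x} \<in> edges G \<and> {x, x'} \<in> edges G \<and> {y, y'} \<in> edges G \<and> {z, z'} \<in> edges G)"
    (is "_ \<longleftrightarrow> ?R")
proof -
  have "simple_graph (sunlet 3)" by (simp add: simple_graph_def sunlet_3)
  note iff = contains_subgraph_iff[OF this, unfolded sunlet_3]
  show ?thesis
  proof
    assume "contains_subgraph G (sunlet 3)"
    then obtain f :: "nat + nat \<Rightarrow> 'a" where
      "inj_on f {Inl 0, Inl 1, Inl 2, Inr 0, Inr 1, Inr 2}"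
      "{f (Inl 0), f (Inl 1)} \<in> edges G" "{f (Inl 1), f (Inl 2)} \<in> edges G"
      "{f (Inl 2), f (Inl 0)} \<in> edges G" "{f (Inl 0), f (Inr 0)} \<in> edges G"
      "{f (Inl 1), f (Inr 1)} \<in> edges G" "{f (Inl 2), f (Inr 2)} \<in> edges G"
      unfolding iff by auto
    moreover from this(1) have "distinct (map f [Inl 0, Inl 1, Inl 2, Inr 0, Inr 1, Inr 2])"
      unfolding distinct_map by simp
    ultimately show ?R unfolding list.map by blast
  next
    assume ?R
    then obtain x y z x' y' z' where "distinct [x, y, z, x', y', z']" "{x, y} \<in> edges G"
      "{y, z} \<in> edges G" "{z, x} \<in> edges G" "{x, x'} \<in> edges G" "{y, y'} \<in> edges G"
      "{z, z'} \<in> edges G" by blast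
    then show "contains_subgraph G (sunlet 3)"
      unfolding iff using edge_imp_verts[OF assms]
      by (intro exI[of _ "case_sum (\<lambda>i. [x, y, z] ! i) (\<lambda>i. [x', y', z'] ! i)"]) simp
  qed
qed

section \<open>Structure of graphs without the forbidden subgraphs\<close>

text \<open>The proof distinguishes whether there is a path on five vertices, failing that one on
  four, failing that only on three. By \<open>no2\<close> every P3 meets such a path, and forbidding
  2P3 or longer paths confines the neighbours of its vertices.\<close>

lemma hit_or_closed:
  fixes adj :: "'a \<Rightarrow> 'a \<Rightarrow> bool"
  assumes sym: "\<And>x y. adj x y \<Longrightarrow> adj y x" and irr: "\<And>x. \<not> adj x x"
    and no2: "\<And>a b c d e f. adj a b \<Longrightarrow> adj b c \<Longrightarrow> a \<noteq> c \<Longrightarrow> adj d e \<Longrightarrow> adj e f \<Longrightarrow> d \<noteq> f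
      \<Longrightarrow> {a, b, c} \<inter> {d, e, f} \<noteq> {}"
    and noC4: "\<And>a b c d. adj a b \<Longrightarrow> adj b c \<Longrightarrow> adj c d \<Longrightarrow> adj d a \<Longrightarrow> a = c \<or> b = d"
    and noS: "\<And>x y z x' y' z'. adj x y \<Longrightarrow> adj y z \<Longrightarrow> adj z x \<Longrightarrow> adj x x' \<Longrightarrow> adj y y' \<Longrightarrow> adj z z'
      \<Longrightarrow> distinct [x, y, z, x', y', z'] \<Longrightarrow> False"
    and p3: "adj a0 b0" "adj b0 c0" "a0 \<noteq> c0"
  obtains (hit) v where "\<And>a b c. adj a b \<Longrightarrow> adj b c \<Longrightarrow> a \<noteq> c \<Longrightarrow> v \<in> {a, b, c}"
  | (closed) B where "card B = 5" "\<And>x. x \<in> B \<Longrightarrow> \<exists>y. adj x y" "\<And>x y. x \<in> B \<Longrightarrow> adj x y \<Longrightarrow> y \<in> B"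
    "\<And>a b c. adj a b \<Longrightarrow> adj b c \<Longrightarrow> a \<noteq> c \<Longrightarrow> B \<inter> {a, b, c} \<noteq> {}"
proof -
  have "(\<exists>v. \<forall>a b c. adj a b \<longrightarrow> adj b c \<longrightarrow> a \<noteq> c \<longrightarrow> v \<in> {a, b, c}) \<or>
    (\<exists>B. card B = 5 \<and> (\<forall>x\<in>B. \<exists>y. adj x y) \<and> (\<forall>x y. x \<in> B \<longrightarrow> adj x y \<longrightarrow> y \<in> B) \<and>
      (\<forall>a b c. adj a b \<longrightarrow> adj b c \<longrightarrow> a \<noteq> c \<longrightarrow> B \<inter> {a, b, c} \<noteq> {}))" (is "?H \<or> ?C")
  proof (cases "\<exists>q b p c d. adj q b \<and> adj b p \<and> adj p c \<and> adj c d \<and> distinct [q, b, p, c, d]")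
    case True
    then obtain q b p c d where P: "adj q b" "adj b p" "adj p c" "adj c d" "distinct [q, b, p, c, d]"
      by blast
    let ?B = "{q, b, p, c, d}"
    have P': "adj b q" "adj p b" "adj c p" "adj d c" using P sym by auto
    \<comment> \<open>An outside neighbour of any path vertex but the middle one would give two
      disjoint copies of P3.\<close>
    have out: "t \<in> ?B" if "x \<in> {q, b, c, d}" "adj x t" for x t
    proof (rule ccontr)
      assume t: "t \<notin> ?B"
      from that(1) consider "x = q" | "x = b" | "x = c" | "x = d" by blast
      then show False
      proof cases
        case 1 then show False using no2[of t q b p c d] t P P' sym that by auto
      next
        case 2 then show False using no2[of t b q p c d] t P P' sym that by auto
      next
        case 3 then show False using no2[of t c d q b p] t P P' sym that by auto
      next
        case 4 then show False using no2[of t d c q b p] t P P' sym that by auto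
      qed
    qed
    have hitB: "?B \<inter> {x, y, z} \<noteq> {}" if "adj x y" "adj y z" "x \<noteq> z" for x y z
      using no2[of q b p x y z] that P by auto
    show ?thesis
    proof (cases "\<exists>t. t \<notin> ?B \<and> adj p t")
      \<comment> \<open>If the middle vertex has no outside neighbour either, the path spans a
        closed set, whatever its chords.\<close>
      case False
      then have "\<forall>x y. x \<in> ?B \<longrightarrow> adj x y \<longrightarrow> y \<in> ?B" using out by blast
      moreover have "card ?B = 5" using P by simp
      moreover have "\<forall>x\<in>?B. \<exists>y. adj x y" using P P' by blast
      ultimately have ?C using hitB by (intro exI[of _ ?B]) auto
      then show ?thesis ..
    next
      case True
      then obtain t where t: "t \<notin> ?B" "adj p t" by blast
      \<comment> \<open>An outside neighbour \<open>t\<close> of \<open>p\<close> leaves no chord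
        between \<open>{q, b}\<close> and \<open>{c, d}\<close>: the chords would create, in turn, a
        C4, a C4, a sunlet on the triangle \<open>b\<close>, \<open>p\<close>, \<open>c\<close>, and
        a 2P3.\<close>
      have "\<not> adj q c" using noC4[of q b p c] P sym by auto
      moreover have "\<not> adj b d" using noC4[of b p c d] P sym by auto
      moreover have "\<not> adj b c" using noS[of b p c q t d] P P' t sym by auto
      moreover have "\<not> adj q d" using no2[of t p b q d c] P P' t sym by auto
      ultimately have none: "\<not> adj q c" "\<not> adj b d" "\<not> adj b c" "\<not> adj q d"
        "\<not> adj c q" "\<not> adj d b" "\<not> adj c b" "\<not> adj d q" using sym by blast+
      have "p \<in> {x, y, z}" if T: "adj x y" "adj y z" "x \<noteq> z" for x y z
      proof (rule ccontr)
        assume np: "p \<notin> {x, y, z}"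
        have step: "v \<in> {q, b}" if "u \<in> {q, b}" "adj u v" "v \<noteq> p" for u v
          using out[of u v] that none by auto
        have step2: "v \<in> {c, d}" if "u \<in> {c, d}" "adj u v" "v \<noteq> p" for u v
          using out[of u v] that none by auto
        have T': "adj y x" "adj z y" using T sym by auto
        have ne: "x \<noteq> y" "y \<noteq> z" using T irr by auto
        \<comment> \<open>Away from \<open>p\<close>, both \<open>{q, b}\<close> and
          \<open>{c, d}\<close> are closed under adjacency, so a P3 meeting one of them would lie
          inside it, which two vertices do not allow.\<close>
        have 1: "x \<in> S \<or> y \<in> S \<or> z \<in> S \<Longrightarrow> x \<in> S \<and> y \<in> S \<and> z \<in> S"
          if "\<And>u v. u \<in> S \<Longrightarrow> adj u v \<Longrightarrow> v \<noteq> p \<Longrightarrow> v \<in> S" for S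
          using that T T' np by blast
        have "\<not> (x \<in> {q, b} \<and> y \<in> {q, b} \<and> z \<in> {q, b})" "\<not> (x \<in> {c, d} \<and> y \<in> {c, d} \<and> z \<in> {c, d})"
          using ne T(3) by auto
        then show False using 1[of "{q, b}"] 1[of "{c, d}"] step step2 hitB[OF T] np by blast
      qed
      then have ?H by blast
      then show ?thesis ..
    qed
  next
    case False
    then have noP5: "\<not> distinct [q, b, p, c, d]"
      if "adj q b" "adj b p" "adj p c" "adj c d" for q b p c d
      using that by blast
    have ?H
    proof (cases "\<exists>a b c d. adj a b \<and> adj b c \<and> adj c d \<and> distinct [a, b, c, d]")
      case True
      \<comment> \<open>The ends \<open>a\<close> and \<open>d\<close> have no outside neighbour for
        lack of a P5, and \<open>c\<close> has none by \<open>cout\<close>. Then \<open>b\<close> or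
        \<open>c\<close> meets every P3, according to whether the chord \<open>a\<close>,
        \<open>c\<close> is absent or present.\<close>
      have main: ?H if P: "adj a b" "adj b c" "adj c d" "distinct [a, b, c, d]"
        and cout: "\<And>t. adj c t \<Longrightarrow> t \<in> {a, b, c, d}" for a b c d
      proof -
        have P': "adj b a" "adj c b" "adj d c" using P sym by auto
        have aout: "t \<in> {a, b, c, d}" if "adj a t" for t
        proof (rule ccontr)
          assume "t \<notin> {a, b, c, d}"
          then show False using noP5[of t a b c d] that P sym by auto
        qed
        have dout: "t \<in> {a, b, c, d}" if "adj d t" for t
        proof (rule ccontr)
          assume "t \<notin> {a, b, c, d}"
          then show False using noP5[of a b c d t] that P by auto
        qed
        have ad: "\<not> adj a d" "\<not> adj d a" using noC4[of a b c d] P sym by auto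
        have hitP: "{a, b, c} \<inter> {x, y, z} \<noteq> {}" if "adj x y" "adj y z" "x \<noteq> z" for x y z
          using no2[of a b c x y z] that P by auto
        show ?thesis
        proof (cases "adj a c")
          case False
          have "b \<in> {x, y, z}" if T: "adj x y" "adj y z" "x \<noteq> z" for x y z
          proof (rule ccontr)
            assume nb: "b \<notin> {x, y, z}"
            have T': "adj y x" "adj z y" using T sym by auto
            have step: "v = c \<or> v = d" if "u = c \<or> u = d" "adj u v" "v \<noteq> b" for u v
              using that cout dout False ad sym by blast
            \<comment> \<open>Without the chord the only neighbour of \<open>a\<close> is
              \<open>b\<close>, and \<open>{c, d}\<close> can be left only through
              \<open>b\<close>.\<close>
            have "a \<notin> {x, y, z}" using aout nb T T' ad False irr sym by blast
            then have "c \<in> {x, y, z}" using hitP[OF T] nb by blast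
            then show False using step T T' nb irr by blast
          qed
          then show ?thesis by blast
        next
          case True
          \<comment> \<open>With the chord, \<open>d\<close>, \<open>c\<close>, \<open>a\<close>,
            \<open>b\<close> is a path too, so \<open>b\<close> is also an end; away from
            \<open>c\<close> the set \<open>{a, b}\<close> is closed under adjacency.\<close>
          have bd: "\<not> adj b d" using noC4[of a c d b] P True sym by auto
          have bout: "t \<in> {a, b, c, d}" if "adj b t" for t
          proof (rule ccontr)
            assume "t \<notin> {a, b, c, d}"
            then show False using noP5[of d c a b t] that P P' True sym by auto
          qed
          have "c \<in> {x, y, z}" if T: "adj x y" "adj y z" "x \<noteq> z" for x y z
          proof (rule ccontr)
            assume nc: "c \<notin> {x, y, z}"
            have T': "adj y x" "adj z y" using T sym by auto
            have step: "v = a \<or> v = b" if "u = a \<or> u = b" "adj u v" "v \<noteq> c" for u v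
              using that aout bout ad bd by blast
            have "a \<in> {x, y, z} \<or> b \<in> {x, y, z}" using hitP[OF T] nc by blast
            then show False using step T T' nc irr by blast
          qed
          then show ?thesis by blast
        qed
      qed
      from True obtain a b c d where P: "adj a b" "adj b c" "adj c d" "distinct [a, b, c, d]" by blast
      have P': "adj b a" "adj c b" "adj d c" using P sym by auto
      show ?thesis
      proof (cases "\<forall>t. adj c t \<longrightarrow> t \<in> {a, b, c, d}")
        case True
        then show ?thesis using main[OF P] by blast
      next
        case False
        then obtain y where y: "adj c y" "y \<notin> {a, b, c, d}" by blast
        \<comment> \<open>Outside neighbours of both inner vertices give a P5 if they coincide and a
          2P3 if they differ. So the reversed path satisfies the assumption of
          \<open>main\<close>.\<close>
        have "t \<in> {a, b, c, d}" if t: "adj b t" for t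
        proof (rule ccontr)
          assume nt: "t \<notin> {a, b, c, d}"
          show False
          proof (cases "t = y")
            case True
            then show False using noP5[of a b t c d] nt y t P sym by auto
          next
            case False
            then show False using no2[of t b a y c d] t nt y P P' sym by auto
          qed
        qed
        then show ?thesis using main[of d c b a] P P' by (auto simp: insert_commute)
      qed
    next
      case False
      then have noP4: "\<not> distinct [a, b, c, d]" if "adj a b" "adj b c" "adj c d" for a b c d
        using that by blast
      \<comment> \<open>Another neighbour at the end of a P3 would extend it to a P4.\<close>
      have out: False if "adj a b" "adj b c" "a \<noteq> c" "adj a t" "t \<notin> {a, b, c}" for a b c t
        using that noP4[of t a b c] sym irr by auto
      have p3': "adj b0 a0" "adj c0 b0" using p3 sym by auto
      have aout: "t \<in> {a0, b0, c0}" if "adj a0 t" for t using out[OF p3 that] by blast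
      have cout: "t \<in> {a0, b0, c0}" if "adj c0 t" for t using out[OF p3'(2,1) _ that] p3 by blast
      show ?thesis
      proof (cases "adj a0 c0")
        \<comment> \<open>Every vertex of the triangle is an end of a P3, so the triangle is a
          component and contains every P3; any of its vertices would serve.\<close>
        case True
        have bout: "t \<in> {a0, b0, c0}" if "adj b0 t" for t
          using out[OF p3'(1) True _ that] p3 irr by blast
        have "a0 \<in> {x, y, z}" if T: "adj x y" "adj y z" "x \<noteq> z" for x y z
        proof (rule ccontr)
          assume na: "a0 \<notin> {x, y, z}"
          have T': "adj y x" "adj z y" using T sym by auto
          have "{a0, b0, c0} \<inter> {x, y, z} \<noteq> {}" using no2[OF p3 T] .
          moreover have step: "v = b0 \<or> v = c0" if "u = b0 \<or> u = c0" "adj u v" "v \<noteq> a0" for u v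
            using that bout cout by blast
          ultimately show False using T T' na irr by blast
        qed
        then show ?thesis by blast
      next
        \<comment> \<open>The ends \<open>a0\<close> and \<open>c0\<close> have no neighbour but
          \<open>b0\<close>, so every P3 through one of them contains \<open>b0\<close>.\<close>
        case False
        have "b0 \<in> {x, y, z}" if T: "adj x y" "adj y z" "x \<noteq> z" for x y z
        proof (rule ccontr)
          assume nb: "b0 \<notin> {x, y, z}"
          have T': "adj y x" "adj z y" using T sym by auto
          have "{a0, b0, c0} \<inter> {x, y, z} \<noteq> {}" using no2[OF p3 T] .
          moreover have "v = b0" if "adj a0 v \<or> adj c0 v" for v
            using that aout[of v] cout[of v] False irr sym by blast
          ultimately show False using T T' nb by blast
        qed
        then show ?thesis by blast
      qed
    qed
    then show ?thesis ..
  qed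
  then show thesis
  proof
    assume ?H
    then obtain v where "\<forall>a b c. adj a b \<longrightarrow> adj b c \<longrightarrow> a \<noteq> c \<longrightarrow> v \<in> {a, b, c}" ..
    then show thesis by (intro hit) blast
  next
    assume ?C
    then obtain B where B: "card B = 5" "\<forall>x\<in>B. \<exists>y. adj x y"
      "\<forall>x y. x \<in> B \<longrightarrow> adj x y \<longrightarrow> y \<in> B"
      "\<forall>a b c. adj a b \<longrightarrow> adj b c \<longrightarrow> a \<noteq> c \<longrightarrow> B \<inter> {a, b, c} \<noteq> {}" by (elim exE conjE)
    show thesis by (rule closed[OF B(1)]) (use B(2-4) in blast)+
  qed
qed

section \<open>Assembly of the three outcomes\<close>

theorem theorem3p2:
  fixes G :: "'a graph"
  assumes "simple_graph G"
  shows "(\<not> contains_subgraph G (path_graph 3) \<longrightarrow> outcome G = \<A>)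
    \<and> (contains_subgraph G (disjoint_union (path_graph 3) (path_graph 3))
          \<or> contains_subgraph G (cycle_graph 4)
          \<or> contains_subgraph G (sunlet 3) \<longrightarrow> outcome G = \<E>)
    \<and> (contains_subgraph G (path_graph 3)
          \<and> \<not> contains_subgraph G (disjoint_union (path_graph 3) (path_graph 3))
          \<and> \<not> contains_subgraph G (cycle_graph 4)
          \<and> \<not> contains_subgraph G (sunlet 3) \<longrightarrow> outcome G = \<S>\<L>)"
proof (intro conjI impI)
  let ?V = "verts G" and ?E = "edges G"
  note G = assms
  have fin: "finite ?V" and card2: "\<And>e. e \<in> ?E \<Longrightarrow> card e = 2"
    using G by (auto simp: simple_graph_def)
  note edge_in = edge_imp_verts[OF G]
  have loop: "{a, a} \<notin> ?E" for a using card2[of "{a, a}"] by auto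
  {
    assume "\<not> contains_subgraph G (path_graph 3)"
    then have no: "\<not> ({a, b} \<in> ?E \<and> {b, c} \<in> ?E \<and> distinct [a, b, c])" for a b c
      using contains_P3_iff[OF G] by blast
    have "p3_free ?E ?V"
      unfolding p3_free_def
    proof (intro ballI impI)
      fix u v w assume "{u, v} \<in> ?E" "{v, w} \<in> ?E"
      then show "u = w" using no[of u v w] loop by auto
    qed
    then show "outcome G = \<A>" using has_outcome_A_if_p3_free[OF G] outcome_eqI fin by blast
  }
  {
    assume "contains_subgraph G (disjoint_union (path_graph 3) (path_graph 3))
      \<or> contains_subgraph G (cycle_graph 4) \<or> contains_subgraph G (sunlet 3)"
    then have "has_outcome G \<E>"
    proof (elim disjE)
      assume "contains_subgraph G (disjoint_union (path_graph 3) (path_graph 3))"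
      then obtain a b c d e f where *: "distinct [a, b, c, d, e, f]" "{a, b} \<in> ?E" "{b, c} \<in> ?E"
        "{d, e} \<in> ?E" "{e, f} \<in> ?E" using contains_2P3_iff[OF G] by blast
      then have "{a, b, c, d, e, f} \<subseteq> ?V" "even (card {a, b, c, d, e, f})" using edge_in by auto
      with wins_Enforcer_2P3[OF *(2-5,1)] show ?thesis using fin by (intro has_outcome_E_if_even)
    next
      assume "contains_subgraph G (cycle_graph 4)"
      then obtain a b c d where *: "distinct [a, b, c, d]" "{a, b} \<in> ?E" "{b, c} \<in> ?E"
        "{c, d} \<in> ?E" "{d, a} \<in> ?E" using contains_C4_iff[OF G] by blast
      then have "{a, b, c, d} \<subseteq> ?V" "even (card {a, b, c, d})" using edge_in by auto
      with wins_Enforcer_C4[OF *(2-5,1)] show ?thesis using fin by (intro has_outcome_E_if_even)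
    next
      assume "contains_subgraph G (sunlet 3)"
      then obtain x y z x' y' z' where *: "distinct [x, y, z, x', y', z']" "{x, y} \<in> ?E" "{y, z} \<in> ?E"
        "{z, x} \<in> ?E" "{x, x'} \<in> ?E" "{y, y'} \<in> ?E" "{z, z'} \<in> ?E"
        using contains_3_sunlet_iff[OF G] by blast
      then have "{x, y, z, x', y', z'} \<subseteq> ?V" "even (card {x, y, z, x', y', z'})" using edge_in by auto
      with wins_Enforcer_3_sunlet[OF *(2-7,1)] show ?thesis using fin by (intro has_outcome_E_if_even)
    qed
    then show "outcome G = \<E>" using outcome_eqI fin by blast
  }
  {
    assume *: "contains_subgraph G (path_graph 3)
      \<and> \<not> contains_subgraph G (disjoint_union (path_graph 3) (path_graph 3))
      \<and> \<not> contains_subgraph G (cycle_graph 4) \<and> \<not> contains_subgraph G (sunlet 3)"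
    then obtain a0 b0 c0 where p3: "distinct [a0, b0, c0]" "{a0, b0} \<in> ?E" "{b0, c0} \<in> ?E"
      using contains_P3_iff[OF G] by blast
    from * have no2: "\<not> (distinct [a, b, c, d, e, f] \<and> {a, b} \<in> ?E \<and> {b, c} \<in> ?E
        \<and> {d, e} \<in> ?E \<and> {e, f} \<in> ?E)" for a b c d e f
      using contains_2P3_iff[OF G] by blast
    from * have noC4: False if "distinct [a, b, c, d]" "{a, b} \<in> ?E" "{b, c} \<in> ?E"
        "{c, d} \<in> ?E" "{d, a} \<in> ?E" for a b c d
      using contains_C4_iff[OF G] that by blast
    from * have noS: False if "{x, y} \<in> ?E" "{y, z} \<in> ?E" "{z, x} \<in> ?E" "{x, x'} \<in> ?E"
        "{y, y'} \<in> ?E" "{z, z'} \<in> ?E" "distinct [x, y, z, x', y', z']" for x y z x' y' z'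
      using contains_3_sunlet_iff[OF G] that by blast
    have "wins_as_second_to_last G Avoider"
    proof (rule hit_or_closed[of "\<lambda>x y. {x, y} \<in> ?E" a0 b0 c0])
      show "{y, x} \<in> ?E" if "{x, y} \<in> ?E" for x y using that by (simp add: insert_commute)
      show "{a, b, c} \<inter> {d, e, f} \<noteq> {}"
        if "{a, b} \<in> ?E" "{b, c} \<in> ?E" "a \<noteq> c" "{d, e} \<in> ?E" "{e, f} \<in> ?E" "d \<noteq> f" for a b c d e f
      proof
        assume "{a, b, c} \<inter> {d, e, f} = {}"
        moreover have "a \<noteq> b" "b \<noteq> c" "d \<noteq> e" "e \<noteq> f" using that loop by auto
        ultimately show False using no2[of a b c d e f] that by auto
      qed
      show "a = c \<or> b = d" if "{a, b} \<in> ?E" "{b, c} \<in> ?E" "{c, d} \<in> ?E" "{d, a} \<in> ?E" for a b c d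
      proof (rule ccontr)
        assume "\<not> (a = c \<or> b = d)"
        moreover have "a \<noteq> b" "b \<noteq> c" "c \<noteq> d" "d \<noteq> a" using that loop by auto
        ultimately show False using noC4[of a b c d] that by auto
      qed
      show False if "{x, y} \<in> ?E" "{y, z} \<in> ?E" "{z, x} \<in> ?E" "{x, x'} \<in> ?E"
        "{y, y'} \<in> ?E" "{z, z'} \<in> ?E" "distinct [x, y, z, x', y', z']" for x y z x' y' z'
        by (rule noS[OF that])
    next
      fix c assume hit: "\<And>x y z. {x, y} \<in> ?E \<Longrightarrow> {y, z} \<in> ?E \<Longrightarrow> x \<noteq> z \<Longrightarrow> c \<in> {x, y, z}"
      \<comment> \<open>The hitting vertex lies on the given P3, which is what places it in
        \<open>?V\<close>.\<close>
      then have "c \<in> {a0, b0, c0}" using p3 by auto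
      then have "c \<in> ?V" using p3 edge_in by blast
      moreover have "p3_free ?E (?V - {c})" unfolding p3_free_def using hit by blast
      ultimately show ?thesis by (rule wins_as_second_to_last_Avoider_if_hit[OF G])
    next
      fix B assume B: "card B = 5" "\<And>x. x \<in> B \<Longrightarrow> \<exists>y. {x, y} \<in> ?E"
        "\<And>x y. x \<in> B \<Longrightarrow> {x, y} \<in> ?E \<Longrightarrow> y \<in> B"
        "\<And>a b c. {a, b} \<in> ?E \<Longrightarrow> {b, c} \<in> ?E \<Longrightarrow> a \<noteq> c \<Longrightarrow> B \<inter> {a, b, c} \<noteq> {}"
      have "B \<subseteq> ?V" using B(2) edge_in by blast
      moreover have "p3_free ?E (?V - B)" unfolding p3_free_def using B(4) by blast
      ultimately show ?thesis
      proof (intro wins_as_second_to_last_Avoider_if_closed[OF G])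
        show False if "distinct [a, b, c, d]" "{a, b} \<in> ?E" "{b, c} \<in> ?E" "{c, d} \<in> ?E" "{d, a} \<in> ?E"
          for a b c d by (rule noC4[OF that])
      qed (use B(1,3) in auto)
    qed (use p3 loop in auto)
    \<comment> \<open>The given P3 is an odd board that Enforcer wins when Avoider opens.\<close>
    moreover have "wins_as_second_to_last G Enforcer"
    proof (rule wins_as_second_to_last_Enforcer_if_odd)
      show "wins ?E Enforcer Avoider {a0, b0, c0} {}" using p3 by (intro wins_Enforcer_P3)
      show "{a0, b0, c0} \<subseteq> ?V" using p3 edge_in by blast
      show "odd (card {a0, b0, c0})" using p3 by simp
    qed (rule fin)
    ultimately show "outcome G = \<S>\<L>" using outcome_eqI[OF fin] by simp
  }
qed

end
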